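(* Let $n\geq 3$, let $\mathfrak{g}=\mathfrak{sl}(n,\mathbb{C})$, and let $\lambda\in\mathbb{C}$ with $\lambda\neq-\frac{1}{8(n+1)}$. Then the two-sided ideal in the tensor algebra $\bigotimes\mathfrak{g}$ generated by all elements $$X\otimes Y-X\circledcirc Y-\tfrac12[X,Y]-\lambda\langle X,Y\rangle,\qquad X,Y\in\mathfrak{g},$$ contains $\mathfrak{g}=\mathfrak{sl}(n,\mathbb{C})$, the first graded piece of $\bigotimes\mathfrak{g}$.
   Context: For a complex simple Lie algebra $\mathfrak{g}$, $\bigotimes\mathfrak{g}=\bigoplus_{s\ge0}\bigotimes^s\mathfrak{g}$ is the full (unital, associative) tensor algebra over $\mathbb{C}$. The Cartan product $\mathfrak{g}\circledcirc\mathfrak{g}\subset\mathfrak{g}\otimes\mathfrak{g}$ is the unique irreducible component of $\mathfrak{g}\otimes\mathfrak{g}$ whose highest weight is twice the highest weight of $\mathfrak{g}$ (the adjoint representation). The map $X\otimes Y\mapsto X\circledcirc Y\in\mathfrak{g}\circledcirc\mathfrak{g}\subset\mathfrak{g}\otimes\mathfrak{g}$ denotes the $\mathfrak{g}$-invariant projection of $\mathfrak{g}\otimes\mathfrak{g}$ onto this component. $[X,Y]$ is the Lie bracket and $\langle X,Y\rangle=\mathrm{tr}(\mathrm{ad}_X\,\mathrm{ad}_Y)$ is the Killing form. The displayed generators are elements of $\bigotimes^2\mathfrak{g}\oplus\mathfrak{g}\oplus\mathbb{C}\subset\bigotimes\mathfrak{g}$. *)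

theory Defs
  imports
    "HOL-Analysis.Analysis"
    "HOL-Library.Function_Algebras"
    "HOL-Algebra.Ideal"
begin

section \<open>The Lie algebra of traceless matrices\<close>

type_synonym 'n cmat = "complex ^ 'n ^ 'n"

definition mscale :: "complex \<Rightarrow> 'n::finite cmat \<Rightarrow> 'n cmat" where
  "mscale c A = (\<chi> i j. c * A $ i $ j)"

global_interpretation cmat: vector_space mscale
  by unfold_locales (auto simp: mscale_def vec_eq_iff algebra_simps)

definition sl :: "'n::finite cmat set" where
  "sl = {A. trace A = 0}"

definition bracket :: "'n::finite cmat \<Rightarrow> 'n cmat \<Rightarrow> 'n cmat" where
  "bracket A B = A ** B - B ** A"

text \<open>The trace of a complex-linear endomorphism \<open>f\<close> of a subspace \<open>V\<close>, computed in some
  complex basis \<open>B\<close> of \<open>V\<close>; the value does not depend on the basis.\<close>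

definition trace_on :: "'n::finite cmat set \<Rightarrow> ('n cmat \<Rightarrow> 'n cmat) \<Rightarrow> complex" where
  "trace_on V f =
     (let B = (SOME B. cmat.independent B \<and> cmat.span B = V)
      in \<Sum>b\<in>B. cmat.representation B (f b) b)"

definition killing :: "'n::finite cmat \<Rightarrow> 'n cmat \<Rightarrow> complex" where
  "killing X Y = trace_on sl (\<lambda>Z. bracket X (bracket Y Z))"


section \<open>The tensor algebra\<close>

text \<open>Tensors are written in the coordinates given by the matrix units: the matrix units form
  a basis of the space of all matrices, so the words in pairs of indices index a basis of its
  tensor algebra. A tensor is the family of its coordinates, and the tensor algebra of a
  subspace \<open>V\<close> is the subalgebra spanned by the products of elements of \<open>V\<close>. The types below
  also contain families of infinite support, which the carrier excludes. The sum of tensors is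
  the pointwise sum of functions; their product is \<open>tmult\<close> (and not the pointwise product).\<close>

type_synonym 'n tensor = "('n \<times> 'n) list \<Rightarrow> complex"

definition tscale :: "complex \<Rightarrow> 'n tensor \<Rightarrow> 'n tensor" where
  "tscale c t = (\<lambda>w. c * t w)"

global_interpretation tensor: vector_space tscale
  by unfold_locales (auto simp: tscale_def fun_eq_iff algebra_simps)

text \<open>\<open>pure [X\<^sub>1, \<dots>, X\<^sub>s]\<close> is $X_1 \otimes \cdots \otimes X_s$; in particular \<open>pure []\<close> is the unit
  and \<open>pure [X]\<close> is \<open>X\<close> in the first graded piece.\<close>

fun pure :: "'n::finite cmat list \<Rightarrow> 'n tensor" where
  "pure [] w = (if w = [] then 1 else 0)"
| "pure (X # Xs) [] = 0"
| "pure (X # Xs) ((i, j) # w) = X $ i $ j * pure Xs w"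

definition tmult :: "'n tensor \<Rightarrow> 'n tensor \<Rightarrow> 'n tensor" where
  "tmult t u = (\<lambda>w. \<Sum>k\<le>length w. t (take k w) * u (drop k w))"

definition tensor_power :: "nat \<Rightarrow> 'n::finite cmat set \<Rightarrow> 'n tensor set" where
  "tensor_power s V = tensor.span {pure Xs | Xs. length Xs = s \<and> set Xs \<subseteq> V}"

definition tensor_algebra :: "'n::finite cmat set \<Rightarrow> 'n tensor ring" where
  "tensor_algebra V =
     \<lparr>carrier = tensor.span {pure Xs | Xs. set Xs \<subseteq> V},
      mult = tmult, one = pure [], zero = 0, add = (+)\<rparr>"

lemma pure_eq_0: "length w \<noteq> length Xs \<Longrightarrow> pure Xs w = 0"
  by (induction Xs w rule: pure.induct) auto

lemma tmult_pure: "tmult (pure Xs) (pure Ys) = pure (Xs @ Ys)"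
proof (induction Xs)
  case Nil
  have "(\<Sum>k\<le>length w. pure [] (take k w) * pure Ys (drop k w)) = pure Ys w" for w
  proof -
    have "(\<Sum>k\<le>length w. pure [] (take k w) * pure Ys (drop k w))
        = (\<Sum>k\<le>length w. if k = 0 then pure Ys w else 0)"
      by (rule sum.cong) auto
    then show ?thesis by simp
  qed
  then show ?case by (simp add: tmult_def fun_eq_iff)
next
  case (Cons X Xs)
  have "tmult (pure (X # Xs)) (pure Ys) w = pure ((X # Xs) @ Ys) w" for w
  proof (cases w)
    case Nil
    then show ?thesis by (simp add: tmult_def)
  next
    case (Cons p v)
    obtain i j where p: "p = (i, j)" by (cases p)
    have "tmult (pure (X # Xs)) (pure Ys) w = X $ i $ j * tmult (pure Xs) (pure Ys) v"
      by (simp add: tmult_def Cons p sum.atMost_Suc_shift sum_distrib_left mult.assoc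
          del: sum.atMost_Suc)
    then show ?thesis using Cons.IH by (simp add: Cons p)
  qed
  then show ?case by blast
qed

lemma tmult_assoc: "tmult (tmult t u) v = tmult t (tmult u v)"
proof
  fix w
  define g where "g = (\<lambda>i j. t (take i w) * u (take j (drop i w)) * v (drop (i + j) w))"
  have "tmult (tmult t u) v w = (\<Sum>k\<le>length w. \<Sum>i\<le>k. g i (k - i))"
    unfolding tmult_def
    by (auto intro!: sum.cong simp: g_def sum_distrib_right min_def drop_take)
  also have "\<dots> = (\<Sum>(i, j)\<in>{(i, j). i + j \<le> length w}. g i j)"
    by (rule sum.triangle_reindex_eq [symmetric])
  also have "{(i, j). i + j \<le> length w} = Sigma {..length w} (\<lambda>i. {..length w - i})"
    by auto
  also have "(\<Sum>(i, j)\<in>\<dots>. g i j) = (\<Sum>i\<le>length w. \<Sum>j\<le>length w - i. g i j)"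
    by (simp add: sum.Sigma)
  also have "\<dots> = tmult t (tmult u v) w"
    unfolding tmult_def
    by (auto intro!: sum.cong simp: g_def sum_distrib_left mult.assoc add.commute)
  finally show "tmult (tmult t u) v w = tmult t (tmult u v) w" .
qed

lemma tmult_add_left: "tmult (t + u) v = tmult t v + tmult u v"
  by (simp add: tmult_def fun_eq_iff distrib_right sum.distrib)

lemma tmult_add_right: "tmult v (t + u) = tmult v t + tmult v u"
  by (simp add: tmult_def fun_eq_iff distrib_left sum.distrib)

lemma tmult_scale_left: "tmult (tscale c t) u = tscale c (tmult t u)"
  by (simp add: tmult_def tscale_def fun_eq_iff sum_distrib_left mult.assoc)

lemma tmult_scale_right: "tmult t (tscale c u) = tscale c (tmult t u)"
  by (simp add: tmult_def tscale_def fun_eq_iff sum_distrib_left mult.left_commute)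

lemma tmult_zero: "tmult 0 t = 0" "tmult t 0 = 0"
  by (simp_all add: tmult_def fun_eq_iff)

lemma tmult_one: "tmult (pure []) t = t" "tmult t (pure []) = t"
proof -
  have "(\<Sum>k\<le>length w. pure [] (take k w) * t (drop k w)) = t w" for w
  proof -
    have "(\<Sum>k\<le>length w. pure [] (take k w) * t (drop k w))
        = (\<Sum>k\<le>length w. if k = 0 then t w else 0)"
      by (rule sum.cong) auto
    then show ?thesis by simp
  qed
  then show "tmult (pure []) t = t" by (simp add: tmult_def fun_eq_iff)
  have "(\<Sum>k\<le>length w. t (take k w) * pure [] (drop k w)) = t w" for w
  proof -
    have "(\<Sum>k\<le>length w. t (take k w) * pure [] (drop k w))
        = (\<Sum>k\<le>length w. if k = length w then t w else 0)"
      by (rule sum.cong) auto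
    then show ?thesis by simp
  qed
  then show "tmult t (pure []) = t" by (simp add: tmult_def fun_eq_iff)
qed

lemma tmult_closed:
  fixes V :: "'n::finite cmat set"
  assumes "t \<in> tensor.span {pure Xs | Xs. set Xs \<subseteq> V}" (is "_ \<in> tensor.span ?P")
    and "u \<in> tensor.span {pure Xs | Xs. set Xs \<subseteq> V}"
  shows "tmult t u \<in> tensor.span {pure Xs | Xs. set Xs \<subseteq> V}"
proof -
  have 1: "tmult p u \<in> tensor.span ?P" if "p \<in> ?P" for p
    using assms(2)
  proof (induction rule: tensor.span_induct_alt)
    case base
    then show ?case by (simp only: tmult_zero tensor.span_zero)
  next
    case (step c x y)
    obtain Xs Ys where "p = pure Xs" "x = pure Ys" "set Xs \<subseteq> V" "set Ys \<subseteq> V"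
      using step(1) \<open>p \<in> ?P\<close> by blast
    then have "tmult p x = pure (Xs @ Ys)" "set (Xs @ Ys) \<subseteq> V"
      by (simp_all add: tmult_pure)
    then have "tmult p x \<in> ?P" by blast
    then show "tmult p (tscale c x + y) \<in> tensor.span ?P"
      using step by (simp add: tmult_add_right tmult_scale_right tensor.span_add
          tensor.span_scale tensor.span_base)
  qed
  show ?thesis
    using assms(1)
  proof (induction rule: tensor.span_induct_alt)
    case base
    then show ?case by (simp only: tmult_zero tensor.span_zero)
  next
    case (step c x y)
    then show "tmult (tscale c x + y) u \<in> tensor.span ?P"
      using 1 by (simp add: tmult_add_left tmult_scale_left tensor.span_add tensor.span_scale)
  qed
qed

text \<open>\<open>Idl\<close> is the intersection of the two-sided ideals that contain the generators, and \<open>ideal\<close>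
  presupposes a ring: without this fact the intersection would be over the empty family.\<close>

lemma ring_tensor_algebra: "ring (tensor_algebra V)"
proof (rule ringI)
  show "abelian_group (tensor_algebra V)"
  proof (rule abelian_groupI)
    fix x assume "x \<in> carrier (tensor_algebra V)"
    then show "\<exists>y\<in>carrier (tensor_algebra V).
        y \<oplus>\<^bsub>tensor_algebra V\<^esub> x = \<zero>\<^bsub>tensor_algebra V\<^esub>"
      by (intro bexI [of _ "- x"]) (auto simp: tensor_algebra_def tensor.span_neg)
  qed (auto simp: tensor_algebra_def tensor.span_add tensor.span_zero add.assoc add.commute)
  have "pure [] \<in> tensor.span {pure Xs | Xs. set Xs \<subseteq> V}"
    by (rule tensor.span_base) (auto intro!: exI [of _ "[]"])
  then show "Group.monoid (tensor_algebra V)"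
    by (intro monoidI)
      (auto simp: tensor_algebra_def tmult_closed tmult_assoc tmult_one)
qed (auto simp: tensor_algebra_def tmult_add_left tmult_add_right)


section \<open>The action on tensors\<close>

text \<open>The matrix \<open>A\<close> acts on the tensor algebra by the derivation that extends \<open>bracket A\<close>:
  the summand for \<open>p\<close> applies \<open>bracket A\<close> to the tensor factor at position \<open>p\<close>.\<close>

definition tact :: "'n::finite cmat \<Rightarrow> 'n tensor \<Rightarrow> 'n tensor" where
  "tact A t = (\<lambda>w. \<Sum>p<length w. \<Sum>m\<in>UNIV.
       A $ fst (w ! p) $ m * t (w[p := (m, snd (w ! p))])
     - t (w[p := (fst (w ! p), m)]) * A $ m $ snd (w ! p))"

lemma tact_add: "tact A (t + u) = tact A t + tact A u"
  by (simp add: tact_def fun_eq_iff sum.distrib [symmetric] algebra_simps)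

lemma tact_scale: "tact A (tscale c t) = tscale c (tact A t)"
  by (simp add: tact_def tscale_def fun_eq_iff sum_distrib_left algebra_simps)

lemma bracket_nth:
  "bracket A X $ i $ j = (\<Sum>m\<in>UNIV. A $ i $ m * X $ m $ j - X $ i $ m * A $ m $ j)"
  by (simp add: bracket_def matrix_matrix_mult_def sum_subtractf)

lemma tact_Nil: "tact A (pure []) = 0"
  by (auto simp: tact_def fun_eq_iff intro!: sum.neutral)

lemma tact_Cons:
  "tact A (pure (X # Xs)) = pure (bracket A X # Xs) + tmult (pure [X]) (tact A (pure Xs))"
proof
  fix w
  show "tact A (pure (X # Xs)) w
      = (pure (bracket A X # Xs) + tmult (pure [X]) (tact A (pure Xs))) w"
  proof (cases w)
    case Nil
    then show ?thesis by (simp add: tact_def tmult_def)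
  next
    case (Cons q v)
    obtain i j where q: "q = (i, j)" by (cases q)
    have "tmult (pure [X]) t w = X $ i $ j * t v" for t
    proof -
      have "tmult (pure [X]) t w
          = (\<Sum>k\<le>length v. X $ i $ j * (pure [] (take k v) * t (drop k v)))"
        by (simp add: tmult_def Cons q sum.atMost_Suc_shift mult.assoc del: sum.atMost_Suc)
      also have "\<dots> = X $ i $ j * tmult (pure []) t v"
        by (simp add: tmult_def sum_distrib_left)
      finally show ?thesis by (simp add: tmult_one)
    qed
    moreover have "tact A (pure (X # Xs)) w
        = bracket A X $ i $ j * pure Xs v + X $ i $ j * tact A (pure Xs) v"
      unfolding tact_def
      by (simp add: Cons q sum.lessThan_Suc_shift bracket_nth sum_distrib_left
          sum_distrib_right algebra_simps del: sum.lessThan_Suc)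
    ultimately show ?thesis by (simp add: Cons q)
  qed
qed

lemma tact_pure_1: "tact A (pure [X]) = pure [bracket A X]"
  by (simp add: tact_Cons tact_Nil tmult_zero)

lemma tact_pure_2: "tact A (pure [X, Y]) = pure [bracket A X, Y] + pure [X, bracket A Y]"
  by (subst tact_Cons) (simp add: tact_pure_1 tmult_pure)


section \<open>Highest weights and the Cartan product\<close>

text \<open>The Cartan subalgebra consists of the diagonal matrices in \<open>sl\<close>, and the positive root
  spaces are spanned by the matrix units above the diagonal, with respect to the given linear
  order of the index type.\<close>

definition cartan_subalgebra :: "'n::finite cmat set" where
  "cartan_subalgebra = {H \<in> sl. \<forall>i j. i \<noteq> j \<longrightarrow> H $ i $ j = 0}"

definition positive_part :: "'n::{finite, linorder} cmat set" where
  "positive_part = {A. \<forall>i j. j \<le> i \<longrightarrow> A $ i $ j = 0}"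

text \<open>The module \<open>M\<close> has scalar multiplication \<open>sc\<close> and action \<open>act\<close>. If \<open>M\<close> is irreducible
  and of finite dimension, the restriction of \<open>\<mu>\<close> to the Cartan subalgebra is unique.\<close>

definition highest_weight ::
    "(complex \<Rightarrow> 'v \<Rightarrow> 'v) \<Rightarrow> ('n::{finite, linorder} cmat \<Rightarrow> 'v \<Rightarrow> 'v) \<Rightarrow> 'v::zero set
      \<Rightarrow> ('n cmat \<Rightarrow> complex) \<Rightarrow> bool" where
  "highest_weight sc act M \<mu> \<longleftrightarrow>
     (\<exists>v\<in>M. v \<noteq> 0 \<and> (\<forall>A\<in>positive_part. act A v = 0)
        \<and> (\<forall>H\<in>cartan_subalgebra. act H v = sc (\<mu> H) v))"

definition submodule :: "'n::finite tensor set \<Rightarrow> bool" where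
  "submodule W \<longleftrightarrow> tensor.subspace W \<and> (\<forall>A\<in>sl. \<forall>t\<in>W. tact A t \<in> W)"

definition irreducible_module :: "'n::finite tensor set \<Rightarrow> bool" where
  "irreducible_module W \<longleftrightarrow>
     submodule W \<and> W \<noteq> {0} \<and> (\<forall>U. submodule U \<and> U \<subseteq> W \<longrightarrow> U = {0} \<or> U = W)"

definition cartan_square :: "'n::{finite, linorder} tensor set" where
  "cartan_square = (THE W. W \<subseteq> tensor_power 2 sl \<and> irreducible_module W \<and>
     (\<exists>\<mu>. highest_weight mscale bracket sl \<mu> \<and> highest_weight tscale tact W (\<lambda>H. 2 * \<mu> H)))"

definition invariant_projection ::
    "'n::finite tensor set \<Rightarrow> 'n tensor set \<Rightarrow> ('n tensor \<Rightarrow> 'n tensor) \<Rightarrow> bool" where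
  "invariant_projection M W P \<longleftrightarrow>
     (\<forall>t\<in>M. P t \<in> W) \<and> (\<forall>t\<in>W. P t = t)
     \<and> (\<forall>t\<in>M. \<forall>u\<in>M. P (t + u) = P t + P u)
     \<and> (\<forall>c. \<forall>t\<in>M. P (tscale c t) = tscale c (P t))
     \<and> (\<forall>A\<in>sl. \<forall>t\<in>M. P (tact A t) = tact A (P t))"

text \<open>The choice determines the projection on \<open>tensor_power 2 sl\<close> only, where it is unique
  because \<open>cartan_square\<close> occurs there with multiplicity one.\<close>

definition cartan_product :: "'n::{finite, linorder} cmat \<Rightarrow> 'n cmat \<Rightarrow> 'n tensor" where
  "cartan_product X Y =
     (SOME P. invariant_projection (tensor_power 2 sl) cartan_square P) (pure [X, Y])"

end

theory Submission
  imports Defs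
begin

text \<open>Write \<open>E\<^sub>i\<^sub>j\<close> for the matrix units, \<open>n\<close> for the size of the matrices and \<open>\<delta>\<close> for the Kronecker
  symbol. The proof rests on an explicit description of the Cartan square: it consists of the
  tensors \<open>t\<close> whose coordinates \<open>t [(i, j), (k, l)]\<close> are symmetric in the row indices \<open>i, k\<close>,
  symmetric in the column indices \<open>j, l\<close>, and traceless (\<open>cartan_square_eq\<close>). So the projection
  onto it kills every tensor that is antisymmetric in the row indices, and the generators then say
  that modulo the ideal the \<open>2 \<times> 2\<close> minors of the matrix of generators are of lower degree.
  Let \<open>x\<^sub>i\<^sub>j\<close> be the traceless part of \<open>E\<^sub>i\<^sub>j\<close>, an element of degree one of the tensor algebra, and put
  \<open>y\<^sub>i\<^sub>j = x\<^sub>i\<^sub>j + \<delta>\<^sub>i\<^sub>j / 2\<close> and \<open>\<kappa> = 1/4 + 2 (n + 1) \<lambda>\<close>. Then the relations become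
  \<open>y\<^sub>i\<^sub>j y\<^sub>k\<^sub>l - y\<^sub>k\<^sub>j y\<^sub>i\<^sub>l = \<delta>\<^sub>k\<^sub>l y\<^sub>i\<^sub>j - \<delta>\<^sub>i\<^sub>l y\<^sub>k\<^sub>j - \<kappa> (\<delta>\<^sub>i\<^sub>j \<delta>\<^sub>k\<^sub>l - \<delta>\<^sub>j\<^sub>k \<delta>\<^sub>i\<^sub>l)\<close>.

  For \<open>\<kappa> = 0\<close> these hold for the operators \<open>y\<^sub>i\<^sub>j = \<partial>\<^sub>j z\<^sub>i\<close> on functions of \<open>z\<^sub>1, \<dots>, z\<^sub>n\<close>, whose
  matrix has rank one up to the order of the factors. For \<open>\<kappa> \<noteq> 0\<close> they are inconsistent: for distinct \<open>a, b, c\<close> the product of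
  \<open>y\<^sub>c\<^sub>b\<close> with the minor \<open>y\<^sub>a\<^sub>a y\<^sub>b\<^sub>b - y\<^sub>b\<^sub>a y\<^sub>a\<^sub>b\<close> can be reduced in two ways, and the results differ by
  \<open>\<kappa> y\<^sub>c\<^sub>b\<close> (\<open>rank_one_relations_force_multiple\<close>). The excluded value of \<open>\<lambda>\<close> is the root of \<open>\<kappa>\<close>,
  and three distinct indices exist because \<open>n \<ge> 3\<close>. So every \<open>E\<^sub>c\<^sub>b\<close> with \<open>c \<noteq> b\<close> lies in the ideal,
  and commutators of these elements give the diagonal part of \<open>sl\<close>.

  Most of the work is the description of the Cartan square and of the projection. Irreducibility
  of the space of symmetric traceless tensors is obtained from the Casimir operator: it acts on
  this space by the scalar \<open>4 n + 4\<close>, whereas on a vector that is killed by the positive root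
  vectors it acts through the weight, and only the weight of \<open>E \<otimes> E\<close>, with \<open>E\<close> a highest root
  vector, gives this scalar. Applied to the quotient of two submodules, this shows that any proper
  inclusion of submodules gains the vector \<open>E \<otimes> E\<close>, which can happen only once
  (\<open>top_tensor_in_difference\<close>). The invariant projection is written down by
  symmetrizing and removing the trace; it is the only one because its kernel does not contain
  the weight of \<open>E \<otimes> E\<close> (\<open>invariant_projection_unique\<close>).\<close>


section \<open>Tensors of degree two in coordinates\<close>

lemma length_2_cases:
  assumes "length w = 2"
  obtains i j k l where "w = [(i, j), (k, l)]"
  using assms by (auto simp: numeral_2_eq_2 length_Suc_conv)

definition quadratic :: "'n tensor set" where
  "quadratic = {t. \<forall>w. length w \<noteq> 2 \<longrightarrow> t w = 0}"

lemma quadratic_eqI: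
  assumes "t \<in> quadratic" "u \<in> quadratic"
    and "\<And>i j k l. t [(i, j), (k, l)] = u [(i, j), (k, l)]"
  shows "t = u"
proof
  fix w
  show "t w = u w"
  proof (cases "length w = 2")
    case True
    then show ?thesis using assms(3) by (auto elim: length_2_cases)
  qed (use assms in \<open>simp add: quadratic_def\<close>)
qed

lemma sum_if_const: "(\<Sum>x\<in>A. if P then f x else 0) = (if P then sum f A else 0)"
  by simp

lemma pure_2_zero: "pure [0, Y] = 0" "pure [X, 0] = 0"
  by (rule quadratic_eqI; simp add: quadratic_def pure_eq_0)+

lemma subspace_quadratic: "tensor.subspace quadratic"
  by (rule tensor.subspaceI) (auto simp: quadratic_def tscale_def)

lemma pure_2_quadratic: "pure [X, Y] \<in> quadratic"
  by (auto simp: quadratic_def pure_eq_0)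

lemma tscale_apply: "tscale c t w = c * t w"
  by (simp add: tscale_def)

lemma tact_zero: "tact A 0 = 0"
  by (simp add: tact_def fun_eq_iff)

lemma tact_quadratic: "t \<in> quadratic \<Longrightarrow> tact A t \<in> quadratic"
  by (auto simp: quadratic_def tact_def intro!: sum.neutral)

lemma tact_apply_2:
  "tact A t [(i, j), (k, l)] =
     (\<Sum>m\<in>UNIV. A $ i $ m * t [(m, j), (k, l)]) - (\<Sum>m\<in>UNIV. t [(i, m), (k, l)] * A $ m $ j)
   + (\<Sum>m\<in>UNIV. A $ k $ m * t [(i, j), (m, l)]) - (\<Sum>m\<in>UNIV. t [(i, j), (k, m)] * A $ m $ l)"
  by (simp add: tact_def sum_subtractf lessThan_Suc numeral_2_eq_2 algebra_simps)

lemma tact_add_matrix: "tact (A + B) t = tact A t + tact B t"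
  by (simp add: tact_def fun_eq_iff sum.distrib [symmetric] algebra_simps)

lemma tact_scale_matrix: "tact (mscale c A) t = tscale c (tact A t)"
  by (simp add: tact_def mscale_def tscale_def fun_eq_iff sum_distrib_left algebra_simps)

text \<open>Scalar matrices act by zero, so the action of a matrix depends only on its traceless part. This
  makes the matrix units, which need not be traceless, available as operators on submodules.\<close>

lemma tact_identity: "tact (mat 1) t = 0"
proof -
  have 1: "(\<Sum>m\<in>UNIV. mat 1 $ i $ m * f m) = f i" "(\<Sum>m\<in>UNIV. f m * mat 1 $ m $ i) = f i"
    for i :: 'a and f :: "'a \<Rightarrow> complex"
    by (simp_all add: mat_def mult_delta_left mult_delta_right)
  show ?thesis
    by (auto simp: tact_def fun_eq_iff sum_subtractf 1)
qed

lemma trace_mscale: "trace (mscale c A) = c * trace A"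
  by (simp add: trace_def mscale_def sum_distrib_left)

lemma mscale_apply: "mscale c A $ i $ j = c * A $ i $ j"
  by (simp add: mscale_def)

definition traceless_part :: "'n::finite cmat \<Rightarrow> 'n cmat" where
  "traceless_part A = A - mscale (trace A / of_nat CARD('n)) (mat 1)"

lemma trace_identity: "trace (mat 1 :: 'n::finite cmat) = of_nat CARD('n)"
  by (simp add: trace_def mat_def)

lemma traceless_part_sl: "traceless_part A \<in> sl"
  by (simp add: traceless_part_def sl_def trace_sub trace_mscale trace_identity)

lemma traceless_part_of_sl: "A \<in> sl \<Longrightarrow> traceless_part A = A"
  by (simp add: traceless_part_def sl_def)

lemma tact_traceless_part: "tact (traceless_part A) t = tact A t"
proof -
  have "A = traceless_part A + mscale (trace A / of_nat CARD('a)) (mat 1)"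
    by (simp add: traceless_part_def)
  then have "tact A t = tact (traceless_part A + mscale (trace A / of_nat CARD('a)) (mat 1)) t"
    by simp
  then show ?thesis
    by (simp only: tact_add_matrix tact_scale_matrix tact_identity tensor.scale_zero_right) simp
qed

lemma submodule_tact: "submodule U \<Longrightarrow> t \<in> U \<Longrightarrow> tact A t \<in> U"
  using traceless_part_sl [of A] tact_traceless_part [of A t] unfolding submodule_def by metis

definition mat_unit :: "'n \<Rightarrow> 'n \<Rightarrow> 'n::finite cmat" where
  "mat_unit a b = (\<chi> i j. if i = a then if j = b then 1 else 0 else 0)"

lemma mat_unit_apply: "mat_unit a b $ i $ j = (if i = a then if j = b then 1 else 0 else 0)"
  by (simp add: mat_unit_def)

lemma trace_mat_unit: "trace (mat_unit a b) = (if a = b then 1 else 0)"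
  by (simp add: trace_def mat_unit_def)

lemma bracket_mat_unit:
  "bracket (mat_unit a b) (mat_unit c d) =
     (if b = c then mat_unit a d else 0) - (if a = d then mat_unit c b else 0)"
  by (auto simp: vec_eq_iff bracket_def matrix_matrix_mult_def mat_unit_apply
      mult_delta_left mult_delta_right)

lemma bracket_add_right: "bracket A (B + C) = bracket A B + bracket A C"
  and bracket_diff_left: "bracket (A - B) C = bracket A C - bracket B C"
  and bracket_diff_right: "bracket A (B - C) = bracket A B - bracket A C"
  and bracket_scale_left: "bracket (mscale c A) B = mscale c (bracket A B)"
  and bracket_scale_right: "bracket A (mscale c B) = mscale c (bracket A B)"
  by (simp_all add: vec_eq_iff bracket_nth mscale_def sum_distrib_left sum.distrib [symmetric]
      sum_subtractf [symmetric] algebra_simps)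

lemma bracket_identity: "bracket (mat 1) A = 0" "bracket A (mat 1) = 0"
  by (simp_all add: bracket_def)

lemma bracket_traceless_part:
  "bracket (traceless_part A) B = bracket A B" "bracket A (traceless_part B) = bracket A B"
  by (simp_all add: traceless_part_def bracket_diff_left bracket_diff_right bracket_scale_left
      bracket_scale_right bracket_identity)

lemma bracket_sl: "bracket A B \<in> sl"
  by (simp add: bracket_def sl_def trace_sub trace_mul_sym [of A B])

lemma tact_mat_unit_apply_2:
  "tact (mat_unit a b) t [(i, j), (k, l)] =
     (if i = a then t [(b, j), (k, l)] else 0) - (if j = b then t [(i, a), (k, l)] else 0)
   + (if k = a then t [(i, j), (b, l)] else 0) - (if l = b then t [(i, j), (k, a)] else 0)"
  by (simp add: tact_apply_2 mat_unit_apply mult_delta_left mult_delta_right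
      if_distrib [of "\<lambda>x. x * _"] if_distrib [of "\<lambda>x. _ * x"] cong: if_cong)

definition partial_trace :: "'n::finite tensor \<Rightarrow> 'n cmat" where
  "partial_trace t = (\<chi> k l. \<Sum>i\<in>UNIV. t [(i, i), (k, l)])"

lemma subspace_tensor_power: "tensor.subspace (tensor_power s V)"
  by (simp add: tensor_power_def tensor.subspace_span)

lemma pure_2_in_tensor_power: "X \<in> V \<Longrightarrow> Y \<in> V \<Longrightarrow> pure [X, Y] \<in> tensor_power 2 V"
  unfolding tensor_power_def by (rule tensor.span_base) (force intro: exI [of _ "[X, Y]"])

lemma tensor_power_2_induct [consumes 1, case_names zero step]:
  assumes "t \<in> tensor_power 2 V" and "P 0"
    and "\<And>c X Y u. X \<in> V \<Longrightarrow> Y \<in> V \<Longrightarrow> u \<in> tensor_power 2 V \<Longrightarrow> P u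
           \<Longrightarrow> P (tscale c (pure [X, Y]) + u)"
  shows "P t"
proof -
  have "t \<in> tensor_power 2 V \<and> P t"
    using assms(1) unfolding tensor_power_def
  proof (induction rule: tensor.span_induct_alt)
    case base
    show ?case using assms(2) tensor.span_zero by blast
  next
    case (step c x y)
    then obtain Xs where Xs: "x = pure Xs" "length Xs = 2" "set Xs \<subseteq> V" by blast
    then obtain X Y where XY: "Xs = [X, Y]"
      by (auto simp: numeral_2_eq_2 length_Suc_conv)
    have "P (tscale c x + y)"
      using assms(3) [of X Y y c] step Xs XY by (auto simp: tensor_power_def)
    moreover have "tscale c x + y \<in> tensor_power 2 V"
      unfolding tensor_power_def
      using step by (intro tensor.span_add tensor.span_scale tensor.span_base [of x]) auto
    ultimately show "tscale c x + y \<in> tensor.span {pure Xs | Xs. length Xs = 2 \<and> set Xs \<subseteq> V}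
        \<and> P (tscale c x + y)"
      by (simp add: tensor_power_def)
  qed
  then show ?thesis by simp
qed

lemma submodule_tensor_power_2: "submodule (tensor_power 2 (sl :: 'n::finite cmat set))"
proof -
  have "tact A t \<in> tensor_power 2 sl" if "t \<in> tensor_power 2 sl" for A and t :: "'n tensor"
    using that
  proof (induction rule: tensor_power_2_induct)
    case zero
    show "tact A 0 \<in> tensor_power 2 sl"
      unfolding tact_zero by (rule tensor.subspace_0 [OF subspace_tensor_power])
  next
    case (step c X Y u)
    then show "tact A (tscale c (pure [X, Y]) + u) \<in> tensor_power 2 sl"
      using subspace_tensor_power
      by (auto simp: tact_add tact_scale tact_pure_2 bracket_sl
        intro!: tensor.subspace_add tensor.subspace_scale pure_2_in_tensor_power)
  qed
  then show ?thesis by (simp add: submodule_def subspace_tensor_power)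
qed

lemma traceless_part_mat_unit_apply:
  "traceless_part (mat_unit a b :: 'n::finite cmat) $ i $ j =
     (if a = i then if b = j then 1 else 0 else 0)
       - (if a = b then if i = j then 1 / of_nat CARD('n) else 0 else 0)"
  by (auto simp: traceless_part_def mat_unit_apply mscale_apply mat_def trace_mat_unit)

text \<open>A quadratic tensor without traces is the combination, with its coordinates as
  coefficients, of the products of the traceless parts of the matrix units.\<close>

lemma tensor_power_2_sl:
  "tensor_power 2 (sl :: 'n::finite cmat set) =
     {t \<in> quadratic. (\<forall>k l. (\<Sum>i\<in>UNIV. t [(i, i), (k, l)]) = 0)
        \<and> (\<forall>i j. (\<Sum>k\<in>UNIV. t [(i, j), (k, k)]) = 0)}" (is "_ = ?R")
proof -
  have sub: "tensor_power 2 sl \<subseteq> ?R"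
  proof
    fix t :: "'n tensor" assume "t \<in> tensor_power 2 sl"
    then show "t \<in> ?R"
    proof (induction rule: tensor_power_2_induct)
      case zero
      then show ?case by (simp add: quadratic_def)
    next
      case (step c X Y u)
      then have 0: "(\<Sum>i\<in>UNIV. X $ i $ i) = 0" "(\<Sum>i\<in>UNIV. Y $ i $ i) = 0"
        by (simp_all add: sl_def trace_def)
      have "(\<Sum>i\<in>UNIV. (tscale c (pure [X, Y]) + u) [(i, i), (k, l)])
          = c * (\<Sum>i\<in>UNIV. X $ i $ i) * Y $ k $ l + (\<Sum>i\<in>UNIV. u [(i, i), (k, l)])" for k l
        by (simp add: tscale_apply sum.distrib sum_distrib_left sum_distrib_right mult_ac)
      moreover have "(\<Sum>i\<in>UNIV. (tscale c (pure [X, Y]) + u) [(k, l), (i, i)])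
          = c * (\<Sum>i\<in>UNIV. Y $ i $ i) * X $ k $ l + (\<Sum>i\<in>UNIV. u [(k, l), (i, i)])" for k l
        by (simp add: tscale_apply sum.distrib sum_distrib_left sum_distrib_right mult_ac)
      moreover have "tscale c (pure [X, Y]) + u \<in> quadratic"
          using step by (intro tensor.subspace_add tensor.subspace_scale subspace_quadratic
            pure_2_quadratic) auto
      ultimately show "tscale c (pure [X, Y]) + u \<in> ?R" using step 0 by auto
    qed
  qed
  moreover have "?R \<subseteq> tensor_power 2 sl"
  proof
    fix t :: "'n tensor" assume t: "t \<in> ?R"
    define E :: "'n \<Rightarrow> 'n \<Rightarrow> 'n cmat" where "E a b = traceless_part (mat_unit a b)" for a b
    define u where "u = (\<Sum>a\<in>UNIV. \<Sum>b\<in>UNIV. \<Sum>c\<in>UNIV. \<Sum>d\<in>UNIV.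
        tscale (t [(a, b), (c, d)]) (pure [E a b, E c d]))"
    have u: "u \<in> tensor_power 2 sl"
      unfolding u_def
      by (intro tensor.subspace_sum subspace_tensor_power tensor.subspace_scale
          pure_2_in_tensor_power) (auto simp: E_def traceless_part_sl)
    have contract: "(\<Sum>a\<in>UNIV. \<Sum>b\<in>UNIV. f a b * E a b $ i $ j) = f i j"
      if "(\<Sum>a\<in>UNIV. f a a) = 0" for f :: "'n \<Rightarrow> 'n \<Rightarrow> complex" and i j
    proof -
      have "(\<Sum>a\<in>UNIV. \<Sum>b\<in>UNIV. f a b * E a b $ i $ j)
          = f i j - (\<Sum>a\<in>UNIV. f a a) * (if i = j then 1 / of_nat CARD('n) else 0)"
        by (simp add: E_def traceless_part_mat_unit_apply right_diff_distrib sum_subtractf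
            if_distrib [of "\<lambda>x. _ * x"] sum_distrib_right sum_divide_distrib sum_if_const
            cong: if_cong)
      then show ?thesis using that by simp
    qed
    have "t = u"
    proof (rule quadratic_eqI)
      show "t \<in> quadratic" using t by simp
      show "u \<in> quadratic" using u sub by blast
      fix i j k l
      have apply_sum: "(\<Sum>a\<in>A. g a) w = (\<Sum>a\<in>A. g a w)" for A :: "'n set" and g :: "'n \<Rightarrow> 'n tensor" and w
        by (induction A rule: infinite_finite_induct) auto
      have "u [(i, j), (k, l)] = (\<Sum>a\<in>UNIV. \<Sum>b\<in>UNIV.
          (\<Sum>c\<in>UNIV. \<Sum>d\<in>UNIV. t [(a, b), (c, d)] * E c d $ k $ l) * E a b $ i $ j)"
        by (simp add: u_def apply_sum tscale_apply sum_distrib_left sum_distrib_right mult_ac)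
      also have "\<dots> = (\<Sum>a\<in>UNIV. \<Sum>b\<in>UNIV. t [(a, b), (k, l)] * E a b $ i $ j)"
        using t by (subst contract) auto
      also have "\<dots> = t [(i, j), (k, l)]"
        using t by (subst contract) auto
      finally show "t [(i, j), (k, l)] = u [(i, j), (k, l)]" by simp
    qed
    then show "t \<in> tensor_power 2 sl" using u by simp
  qed
  ultimately show ?thesis by (rule subset_antisym)
qed

section \<open>The symmetric traceless tensors\<close>

text \<open>In the description of \<open>gl\<close> as vectors tensored with covectors, these are the tensors in the product
  of the symmetric squares of both factors that are killed by contraction.\<close>

definition symmetric_traceless :: "'n::finite tensor set" where
  "symmetric_traceless = {t \<in> quadratic.
     (\<forall>i j k l. t [(k, j), (i, l)] = t [(i, j), (k, l)]) \<and>
     (\<forall>i j k l. t [(i, l), (k, j)] = t [(i, j), (k, l)]) \<and>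
     (\<forall>k l. (\<Sum>i\<in>UNIV. t [(i, i), (k, l)]) = 0)}"

text \<open>By symmetry the vanishing of one contraction entails the vanishing of all four.\<close>

lemma symmetric_traceless_traces:
  assumes "t \<in> symmetric_traceless"
  shows "(\<Sum>m\<in>UNIV. t [(m, m), (k, l)]) = 0" "(\<Sum>m\<in>UNIV. t [(k, l), (m, m)]) = 0"
    and "(\<Sum>m\<in>UNIV. t [(m, l), (k, m)]) = 0" "(\<Sum>m\<in>UNIV. t [(k, m), (m, l)]) = 0"
proof -
  have up: "t [(k, j), (i, l)] = t [(i, j), (k, l)]"
    and low: "t [(i, l), (k, j)] = t [(i, j), (k, l)]" for i j k l
    using assms unfolding symmetric_traceless_def by blast+
  show *: "(\<Sum>m\<in>UNIV. t [(m, m), (k, l)]) = 0" for k l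
    using assms by (simp add: symmetric_traceless_def)
  have "t [(k, l), (m, m)] = t [(m, m), (k, l)]" for m
    using up [of k l m m] low [of m m k l] by simp
  then show "(\<Sum>m\<in>UNIV. t [(k, l), (m, m)]) = 0" by (simp add: *)
  have "t [(m, l), (k, m)] = t [(m, m), (k, l)]" for m
    by (rule low)
  then show "(\<Sum>m\<in>UNIV. t [(m, l), (k, m)]) = 0" by (simp add: *)
  have "t [(k, m), (m, l)] = t [(m, m), (k, l)]" for m
    by (rule up)
  then show "(\<Sum>m\<in>UNIV. t [(k, m), (m, l)]) = 0" by (simp add: *)
qed

lemma symmetric_traceless_quadratic: "t \<in> symmetric_traceless \<Longrightarrow> t \<in> quadratic"
  by (simp add: symmetric_traceless_def)

lemma symmetric_traceless_subset: "symmetric_traceless \<subseteq> tensor_power 2 sl"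
  by (auto simp: tensor_power_2_sl symmetric_traceless_traces symmetric_traceless_quadratic)

lemma subspace_symmetric_traceless: "tensor.subspace symmetric_traceless"
  by (rule tensor.subspaceI)
    (auto simp: symmetric_traceless_def quadratic_def tscale_def sum.distrib
      simp flip: sum_distrib_left)

lemma sum_tact_trace:
  "(\<Sum>i\<in>UNIV. tact A t [(i, i), (k, l)]) =
     bracket A (partial_trace t) $ k $ l"
proof -
  have "(\<Sum>i\<in>UNIV. \<Sum>m\<in>UNIV. A $ i $ m * t [(m, i), (k, l)]) =
      (\<Sum>i\<in>UNIV. \<Sum>m\<in>UNIV. t [(i, m), (k, l)] * A $ m $ i)"
    by (subst sum.swap) (simp add: mult.commute)
  moreover have "(\<Sum>i\<in>UNIV. \<Sum>m\<in>UNIV. A $ k $ m * t [(i, i), (m, l)]) =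
      (\<Sum>m\<in>UNIV. A $ k $ m * partial_trace t $ m $ l)"
    by (subst sum.swap) (simp add: partial_trace_def sum_distrib_left)
  moreover have "(\<Sum>i\<in>UNIV. \<Sum>m\<in>UNIV. t [(i, i), (k, m)] * A $ m $ l) =
      (\<Sum>m\<in>UNIV. partial_trace t $ k $ m * A $ m $ l)"
    by (subst sum.swap) (simp add: partial_trace_def sum_distrib_right)
  ultimately show ?thesis
    by (simp add: tact_apply_2 sum.distrib sum_subtractf bracket_nth)
qed

lemma submodule_symmetric_traceless: "submodule (symmetric_traceless :: 'n::finite tensor set)"
proof -
  have "tact A t \<in> symmetric_traceless" if t: "t \<in> symmetric_traceless"
    for A and t :: "'n tensor"
  proof -
    have up: "t [(k, j), (i, l)] = t [(i, j), (k, l)]"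
      and low: "t [(i, l), (k, j)] = t [(i, j), (k, l)]" for i j k l
      using t unfolding symmetric_traceless_def by blast+
    have "partial_trace t = 0"
      by (simp add: partial_trace_def vec_eq_iff symmetric_traceless_traces [OF t])
    then have "(\<Sum>i\<in>UNIV. tact A t [(i, i), (k, l)]) = 0" for k l
      by (simp add: sum_tact_trace bracket_def)
    moreover have "tact A t \<in> quadratic"
      using t by (simp add: symmetric_traceless_quadratic tact_quadratic)
    moreover have "tact A t [(k, j), (i, l)] = tact A t [(i, j), (k, l)]" for i j k l
      using up [of i _ k] by (simp add: tact_apply_2 up [of k] up [of _ _ i])
    moreover have "tact A t [(i, l), (k, j)] = tact A t [(i, j), (k, l)]" for i j k l
      by (simp add: tact_apply_2 low [of i l] low [of _ l _ j] low [of i _ k])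
    ultimately show ?thesis by (simp add: symmetric_traceless_def)
  qed
  then show ?thesis
    by (simp add: submodule_def subspace_symmetric_traceless)
qed

section \<open>Weight components of submodules\<close>

text \<open>Diagonal matrices act on tensors by multiplication with functions of the word. Such functions,
  and the functions generated from them, are multipliers of every submodule.\<close>

definition multiplier :: "'n tensor set \<Rightarrow> (('n \<times> 'n) list \<Rightarrow> complex) \<Rightarrow> bool" where
  "multiplier U f \<longleftrightarrow> (\<forall>t\<in>U. (\<lambda>w. f w * t w) \<in> U)"

lemma multiplier_add:
  assumes "tensor.subspace U" "multiplier U f" "multiplier U g"
  shows "multiplier U (\<lambda>w. f w + g w)"
  unfolding multiplier_def
proof
  fix t assume "t \<in> U"
  then have "(\<lambda>w. f w * t w) + (\<lambda>w. g w * t w) \<in> U"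
    using assms by (intro tensor.subspace_add) (auto simp: multiplier_def)
  moreover have "(\<lambda>w. f w * t w) + (\<lambda>w. g w * t w) = (\<lambda>w. (f w + g w) * t w)"
    by (simp add: fun_eq_iff distrib_right)
  ultimately show "(\<lambda>w. (f w + g w) * t w) \<in> U" by simp
qed

lemma multiplier_mult:
  assumes "multiplier U f" "multiplier U g"
  shows "multiplier U (\<lambda>w. f w * g w)"
  using assms by (auto simp: multiplier_def mult.assoc)

lemma multiplier_const: "tensor.subspace U \<Longrightarrow> multiplier U (\<lambda>w. c)"
  using tensor.subspace_scale [of U _ c] by (auto simp: multiplier_def tscale_def)

lemma multiplier_sum:
  assumes "tensor.subspace U" "\<And>x. x \<in> A \<Longrightarrow> multiplier U (f x)"
  shows "multiplier U (\<lambda>w. \<Sum>x\<in>A. f x w)"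
  using assms(2)
  by (induction A rule: infinite_finite_induct)
    (auto intro: multiplier_add multiplier_const assms(1))

lemma multiplier_prod:
  assumes "tensor.subspace U" "\<And>x. x \<in> A \<Longrightarrow> multiplier U (f x)"
  shows "multiplier U (\<lambda>w. \<Prod>x\<in>A. f x w)"
  using assms(2)
  by (induction A rule: infinite_finite_induct)
    (auto intro: multiplier_mult multiplier_const assms(1))

lemma finite_words_2: "finite {w :: ('n::finite \<times> 'n) list. length w = 2}"
  using finite_lists_length_eq [of "UNIV :: ('n \<times> 'n) set" 2] by simp

text \<open>Only finitely many words carry a quadratic tensor, so on these words any function of \<open>d\<close> is a
  polynomial in \<open>d\<close> by Lagrange interpolation. In particular a submodule contains the weight
  components of its elements.\<close>

lemma multiplier_compose:
  fixes U :: "'n::finite tensor set"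
  assumes "tensor.subspace U" "U \<subseteq> quadratic" "multiplier U d"
  shows "multiplier U (\<lambda>w. \<phi> (d w))"
proof -
  define F where "F = d ` {w. length w = 2}"
  have F: "finite F" by (simp add: F_def finite_words_2)
  define L where "L = (\<lambda>w. \<Sum>c\<in>F. \<phi> c * (\<Prod>c'\<in>F - {c}. (d w + - c') * (1 / (c - c'))))"
  have L: "multiplier U L"
    unfolding L_def
    by (intro multiplier_sum multiplier_prod multiplier_mult multiplier_add multiplier_const
        assms)
  have "L w = \<phi> (d w)" if "length w = 2" for w
  proof -
    have dw: "d w \<in> F" using that by (auto simp: F_def)
    have "L w = (\<Sum>c\<in>F. if c = d w then \<phi> c else 0)"
      unfolding L_def
    proof (rule sum.cong)
      fix c assume "c \<in> F"
      show "\<phi> c * (\<Prod>c'\<in>F - {c}. (d w + - c') * (1 / (c - c'))) = (if c = d w then \<phi> c else 0)"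
      proof (cases "c = d w")
        case True
        then have "(\<Prod>c'\<in>F - {c}. (d w + - c') * (1 / (c - c'))) = 1"
          by (intro prod.neutral) auto
        then show ?thesis using True by simp
      next
        case False
        then have "(\<Prod>c'\<in>F - {c}. (d w + - c') * (1 / (c - c'))) = 0"
          using F dw by (intro prod_zero) auto
        then show ?thesis using False by simp
      qed
    qed simp
    then show ?thesis using F dw by simp
  qed
  then have "(\<lambda>w. \<phi> (d w) * t w) = (\<lambda>w. L w * t w)" if "t \<in> U" for t
    using that assms(2) by (fastforce simp: quadratic_def)
  then show ?thesis using L by (simp add: multiplier_def)
qed

definition weight :: "'n \<Rightarrow> ('n \<times> 'n) list \<Rightarrow> int" where
  "weight a w = (\<Sum>p\<leftarrow>w. of_bool (fst p = a) - of_bool (snd p = a))"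

lemma weight_2:
  "weight a [(i, j), (k, l)] =
     of_bool (i = a) - of_bool (j = a) + of_bool (k = a) - of_bool (l = a)"
  by (simp add: weight_def)

lemma tact_mat_unit_diagonal:
  assumes "t \<in> quadratic"
  shows "tact (mat_unit a a) t = (\<lambda>w. of_int (weight a w) * t w)"
proof (rule quadratic_eqI)
  show "(\<lambda>w. of_int (weight a w) * t w) \<in> quadratic"
    using assms by (simp add: quadratic_def)
  show "tact (mat_unit a a) t [(i, j), (k, l)] =
      of_int (weight a [(i, j), (k, l)]) * t [(i, j), (k, l)]" for i j k l
    by (simp add: tact_mat_unit_apply_2 weight_2 algebra_simps)
qed (simp add: assms tact_quadratic)

lemma tact_mat_unit_commutator:
  assumes "t \<in> quadratic" "a \<noteq> b"
  shows "tact (mat_unit a b) (tact (mat_unit b a) t) =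
    tact (mat_unit b a) (tact (mat_unit a b) t)
      + (\<lambda>w. of_int (weight a w - weight b w) * t w)"
proof (rule quadratic_eqI)
  show "tact (mat_unit b a) (tact (mat_unit a b) t)
      + (\<lambda>w. of_int (weight a w - weight b w) * t w) \<in> quadratic"
    using assms(1)
    by (intro tensor.subspace_add subspace_quadratic tact_quadratic) (auto simp: quadratic_def)
  show "tact (mat_unit a b) (tact (mat_unit b a) t) [(i, j), (k, l)] =
    (tact (mat_unit b a) (tact (mat_unit a b) t)
      + (\<lambda>w. of_int (weight a w - weight b w) * t w)) [(i, j), (k, l)]" for i j k l
    using assms(2) by (auto simp: tact_mat_unit_apply_2 weight_2 algebra_simps)
qed (simp add: assms tact_quadratic)

lemma sum_apply: "(\<Sum>a\<in>A. g a) w = (\<Sum>a\<in>A. g a w)" for g :: "'a \<Rightarrow> 'n tensor"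
  by (induction A rule: infinite_finite_induct) auto

section \<open>Irreducibility by the Casimir operator\<close>

text \<open>The Casimir operator of \<open>gl\<close>, expanded in coordinates, is \<open>4 n\<close> plus twice the two exchanges of
  rows and of columns minus twice the four contractions. The exchanges act by one and the
  contractions by zero.\<close>

lemma casimir_symmetric_traceless:
  fixes t :: "'n::finite tensor"
  assumes "t \<in> symmetric_traceless"
  shows "(\<Sum>a\<in>UNIV. \<Sum>b\<in>UNIV. tact (mat_unit a b) (tact (mat_unit b a) t))
    = tscale (4 * of_nat CARD('n) + 4) t"
proof (rule quadratic_eqI)
  have q: "t \<in> quadratic" using assms by (simp add: symmetric_traceless_def)
  show "(\<Sum>a\<in>UNIV. \<Sum>b\<in>UNIV. tact (mat_unit a b) (tact (mat_unit b a) t)) \<in> quadratic"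
    by (intro tensor.subspace_sum subspace_quadratic tact_quadratic q)
  show "tscale (4 * of_nat CARD('n) + 4) t \<in> quadratic"
    by (intro tensor.subspace_scale subspace_quadratic q)
  have up: "t [(k, j), (i, l)] = t [(i, j), (k, l)]"
    and low: "t [(i, l), (k, j)] = t [(i, j), (k, l)]" for i j k l
    using assms unfolding symmetric_traceless_def by blast+
  note tr = symmetric_traceless_traces [OF assms]
  fix i j k l
  show "(\<Sum>a\<in>UNIV. \<Sum>b\<in>UNIV. tact (mat_unit a b) (tact (mat_unit b a) t)) [(i, j), (k, l)]
    = tscale (4 * of_nat CARD('n) + 4) t [(i, j), (k, l)]"
    by (simp add: sum_apply tact_mat_unit_apply_2 tscale_apply sum.distrib sum_subtractf tr
        sum_if_const up [of k j i l] low [of i l k j] distrib_right cong: if_cong)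
qed

text \<open>The positive root vectors are the matrix units above the diagonal, so the highest root vector is
  the matrix unit in the upper right corner.\<close>

abbreviation top_word :: "('n::{finite, linorder} \<times> 'n) list" where
  "top_word \<equiv> [(Min UNIV, Max UNIV), (Min UNIV, Max UNIV)]"

definition top_tensor :: "'n::{finite, linorder} tensor" where
  "top_tensor = pure [mat_unit (Min UNIV) (Max UNIV), mat_unit (Min UNIV) (Max UNIV)]"

lemma top_tensor_apply: "top_tensor w = (if w = top_word then 1 else 0)"
proof -
  have "top_tensor = (\<lambda>w. if w = top_word then 1 else (0 :: complex))"
    by (rule quadratic_eqI)
      (auto simp: top_tensor_def quadratic_def mat_unit_apply pure_eq_0)
  from fun_cong [OF this, of w] show ?thesis .
qed

text \<open>This is the value of the Casimir operator on a vector of this weight that is killed by the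
  positive root vectors: for \<open>a < b\<close> the product \<open>E\<^sub>b\<^sub>a E\<^sub>a\<^sub>b\<close> vanishes there, and \<open>E\<^sub>a\<^sub>b E\<^sub>b\<^sub>a\<close> is the
  commutator.\<close>

definition casimir_weight :: "('n::{finite, linorder} \<times> 'n) list \<Rightarrow> int" where
  "casimir_weight w = (\<Sum>a\<in>UNIV. \<Sum>b\<in>UNIV.
     if a = b then (weight a w)\<^sup>2 else if a < b then weight a w - weight b w else 0)"

text \<open>The squares contribute at most \<open>8\<close>. The differences contribute \<open>g i - g j + g k - g l\<close>, where
  \<open>g a\<close> is the number of indices above \<open>a\<close> minus the number of those below, so that each of the four
  terms is at most \<open>n - 1\<close>, with equality only for the least row index and the greatest
  column index. The bound \<open>8 + 4 (n - 1)\<close> is the value in the hypothesis.\<close>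

lemma casimir_weight_top:
  fixes w :: "('n::{finite, linorder} \<times> 'n) list"
  assumes "length w = 2" and "casimir_weight w = 4 * int CARD('n) + 4"
  shows "w = top_word"
proof -
  obtain i j k l where w: "w = [(i, j), (k, l)]"
    using assms(1) by (rule length_2_cases)
  define g where "g a = int (card {a<..}) - int (card {..<a})" for a :: 'n
  have pair: "(\<Sum>a\<in>UNIV. weight a w * f a) = f i - f j + f k - f l" for f :: "'n \<Rightarrow> int"
    by (simp add: w weight_2 of_bool_def distrib_right left_diff_distrib sum.distrib sum_subtractf
        mult_delta_left)
  have total: "int (card {a<..}) + int (card {..<a}) = int CARD('n) - 1" for a :: 'n
  proof -
    have "(UNIV :: 'n set) = insert a ({a<..} \<union> {..<a})" by auto
    then have "CARD('n) = card (insert a ({a<..} \<union> {..<a}))" by simp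
    also have "\<dots> = Suc (card ({a<..} \<union> {..<a}))"
      by simp
    also have "card ({a<..} \<union> {..<a}) = card {a<..} + card {..<a}"
      by (rule card_Un_disjoint) auto
    finally show ?thesis by simp
  qed
  have count: "(\<Sum>b\<in>UNIV. if P b then c else 0) = c * int (card {b. P b})"
    for P :: "'n \<Rightarrow> bool" and c :: int
    by (simp add: sum.If_cases)
  have "casimir_weight w =
      (\<Sum>a\<in>UNIV. \<Sum>b\<in>UNIV. if a = b then weight a w * weight a w else 0)
        + (\<Sum>a\<in>UNIV. \<Sum>b\<in>UNIV. if a < b then weight a w else 0)
        - (\<Sum>a\<in>UNIV. \<Sum>b\<in>UNIV. if a < b then weight b w else 0)"
    unfolding casimir_weight_def sum.distrib [symmetric] sum_subtractf [symmetric]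
    by (intro sum.cong refl) (auto simp: power2_eq_square)
  also have "(\<Sum>a\<in>UNIV. \<Sum>b\<in>UNIV. if a < b then weight b w else 0)
      = (\<Sum>b\<in>UNIV. \<Sum>a\<in>UNIV. if a < b then weight b w else 0)"
    by (rule sum.swap)
  also have "(\<Sum>a\<in>UNIV. \<Sum>b\<in>UNIV. if a = b then weight a w * weight a w else 0)
        + (\<Sum>a\<in>UNIV. \<Sum>b\<in>UNIV. if a < b then weight a w else 0)
        - (\<Sum>b\<in>UNIV. \<Sum>a\<in>UNIV. if a < b then weight b w else 0)
      = (\<Sum>a\<in>UNIV. weight a w * weight a w) + (\<Sum>a\<in>UNIV. weight a w * g a)"
    by (simp add: count g_def right_diff_distrib sum_subtractf greaterThan_def lessThan_def)
  also have "\<dots> = (weight i w - weight j w + weight k w - weight l w) + (g i - g j + g k - g l)"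
    by (simp only: pair)
  finally have "(weight i w - weight j w + weight k w - weight l w) + (g i - g j + g k - g l)
      = 4 * int CARD('n) + 4"
    using assms(2) by simp
  moreover have "weight i w \<le> 2" "- weight j w \<le> 2" "weight k w \<le> 2" "- weight l w \<le> 2"
    by (auto simp: w weight_2 of_bool_def)
  moreover have "g a \<le> int CARD('n) - 1" "- g a \<le> int CARD('n) - 1" for a
    using total [of a] by (auto simp: g_def)
  ultimately have g: "g i = int CARD('n) - 1" "g k = int CARD('n) - 1"
      "- g j = int CARD('n) - 1" "- g l = int CARD('n) - 1"
    by smt+
  have lo: "a = Min UNIV" if "g a = int CARD('n) - 1" for a
  proof -
    have "card {..<a} = 0" using that total [of a] unfolding g_def by linarith
    then have "{..<a} = {}" by simp
    then have "\<And>b. a \<le> b" by (auto simp: lessThan_def not_less)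
    then show ?thesis by (intro Min_eqI [symmetric]) auto
  qed
  have hi: "a = Max UNIV" if "- g a = int CARD('n) - 1" for a
  proof -
    have "card {a<..} = 0" using that total [of a] unfolding g_def by linarith
    then have "{a<..} = {}" by simp
    then have "\<And>b. b \<le> a" by (auto simp: greaterThan_def not_less)
    then show ?thesis by (intro Max_eqI [symmetric]) auto
  qed
  show ?thesis
    using lo [OF g(1)] lo [OF g(2)] hi [OF g(3)] hi [OF g(4)] by (simp add: w)
qed

text \<open>A grading that the positive root vectors raise: both replacing a row index by a smaller one and
  replacing a column index by a greater one increase it.\<close>

definition height :: "('n::{finite, linorder} \<times> 'n) list \<Rightarrow> nat" where
  "height w = (\<Sum>p\<leftarrow>w. card {fst p<..} + card {..<snd p})"

lemma tact_mat_unit_raises_height: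
  fixes t :: "'n::{finite, linorder} tensor"
  assumes "t \<in> quadratic" "a < b" "\<And>w. t w \<noteq> 0 \<Longrightarrow> m \<le> height w"
    and "tact (mat_unit a b) t w \<noteq> 0"
  shows "Suc m \<le> height w"
proof -
  have "length w = 2"
    using assms(4) tact_quadratic [OF assms(1)] by (auto simp: quadratic_def)
  then obtain i j k l where w: "w = [(i, j), (k, l)]"
    by (rule length_2_cases)
  have "card {b<..} < card {a<..}" "card {..<a} < card {..<b}"
    using assms(2) by (auto intro!: psubset_card_mono)
  moreover have "(i = a \<and> t [(b, j), (k, l)] \<noteq> 0) \<or> (j = b \<and> t [(i, a), (k, l)] \<noteq> 0)
      \<or> (k = a \<and> t [(i, j), (b, l)] \<noteq> 0) \<or> (l = b \<and> t [(i, j), (k, a)] \<noteq> 0)"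
    using assms(4) by (auto simp: w tact_mat_unit_apply_2 split: if_splits)
  ultimately show ?thesis
    by (auto simp: w height_def dest!: assms(3))
qed

lemma submodule_subspace: "submodule U \<Longrightarrow> tensor.subspace U"
  by (simp add: submodule_def)

lemma multiplier_diff:
  assumes "tensor.subspace U" "multiplier U f" "multiplier U g"
  shows "multiplier U (\<lambda>w. f w - g w)"
proof -
  have "multiplier U (\<lambda>w. f w + (- 1) * g w)"
    by (intro multiplier_add multiplier_mult multiplier_const assms)
  then show ?thesis by simp
qed

lemma multiplier_weight:
  assumes "submodule U" "U \<subseteq> quadratic"
  shows "multiplier U (\<lambda>w. of_int (weight a w))"
  unfolding multiplier_def
proof
  fix t assume "t \<in> U"
  then show "(\<lambda>w. of_int (weight a w) * t w) \<in> U"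
    using submodule_tact [OF assms(1), of t "mat_unit a a"] assms(2)
      tact_mat_unit_diagonal [of t a] by auto
qed

text \<open>A highest weight vector in the quotient \<open>Z / U\<close>: take an element of \<open>Z\<close> outside \<open>U\<close> whose lowest
  words have the greatest possible height.\<close>

lemma exists_highest_modulo:
  fixes U Z :: "'n::{finite, linorder} tensor set"
  assumes "submodule U" "submodule Z" "U \<subseteq> Z" "U \<noteq> Z" "Z \<subseteq> quadratic"
  obtains t where "t \<in> Z" "t \<notin> U" "\<And>a b. a < b \<Longrightarrow> tact (mat_unit a b) t \<in> U"
proof -
  define S where "S m = {t \<in> Z - U. \<forall>w. t w \<noteq> 0 \<longrightarrow> m \<le> height w}" for m
  define N where "N = Max (height ` {w :: ('n \<times> 'n) list. length w = 2})"
  have "S (Suc N) = {}"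
  proof -
    have "height w \<le> N" if "length w = 2" for w :: "('n \<times> 'n) list"
      using that finite_words_2 by (auto simp: N_def intro!: Max_ge)
    moreover have "t = 0" if "\<And>w. t w \<noteq> 0 \<Longrightarrow> Suc N \<le> height w" "t \<in> quadratic"
      for t :: "'n tensor"
    proof
      fix w show "t w = 0 w"
        using that calculation [of w] by (cases "length w = 2") (fastforce simp: quadratic_def)+
    qed
    ultimately show ?thesis
      using assms(5) tensor.subspace_0 [OF submodule_subspace [OF assms(1)]]
      unfolding S_def by blast
  qed
  moreover have "S 0 \<noteq> {}"
    using assms(3,4) by (auto simp: S_def)
  ultimately have "\<not> (\<forall>m. S m \<noteq> {} \<longrightarrow> S (Suc m) \<noteq> {})"
    using nat_induct [of "\<lambda>m. S m \<noteq> {}" "Suc N"] by blast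
  then obtain m where m: "S m \<noteq> {}" "S (Suc m) = {}" by blast
  then obtain t where t: "t \<in> Z" "t \<notin> U" "\<And>w. t w \<noteq> 0 \<Longrightarrow> m \<le> height w"
    by (auto simp: S_def)
  have "tact (mat_unit a b) t \<in> U" if "a < b" for a b
  proof (rule ccontr)
    assume "tact (mat_unit a b) t \<notin> U"
    moreover have "tact (mat_unit a b) t \<in> Z"
      by (rule submodule_tact [OF assms(2) t(1)])
    moreover have "Suc m \<le> height w" if "tact (mat_unit a b) t w \<noteq> 0" for w
      using tact_mat_unit_raises_height [OF _ \<open>a < b\<close> t(3) that] t(1) assms(5) by blast
    ultimately have "tact (mat_unit a b) t \<in> S (Suc m)" by (simp add: S_def)
    then show False using m(2) by blast
  qed
  then show ?thesis using that t by blast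
qed

text \<open>Modulo \<open>U\<close>, a highest weight vector \<open>t\<close> of \<open>Z / U\<close> is multiplied by the Casimir operator with
  \<open>casimir_weight\<close>, but also with the constant \<open>c = 4 n + 4\<close>. Hence \<open>(c - casimir_weight) t\<close> lies in
  \<open>U\<close>, and inverting the factor where it does not vanish puts all of \<open>t\<close> but its coordinate at the
  top word into \<open>U\<close>.\<close>

lemma top_tensor_in_difference:
  fixes U Z :: "'n::{finite, linorder} tensor set"
  assumes "submodule U" "submodule Z" "U \<subseteq> Z" "U \<noteq> Z" "Z \<subseteq> symmetric_traceless"
  shows "top_tensor \<in> Z" "top_tensor \<notin> U"
proof -
  define c :: complex where "c = 4 * of_nat CARD('n) + 4"
  have sub: "tensor.subspace U" "tensor.subspace Z"
    using assms by (simp_all add: submodule_subspace)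
  have q: "Z \<subseteq> quadratic" "U \<subseteq> quadratic"
    using assms(3,5) symmetric_traceless_quadratic by blast+
  obtain t where t: "t \<in> Z" "t \<notin> U" and raise: "\<And>a b. a < b \<Longrightarrow> tact (mat_unit a b) t \<in> U"
    using exists_highest_modulo [OF assms(1-4) q(1)] by blast
  have tq: "t \<in> quadratic" using t q by blast
  define d where "d w = (of_int (casimir_weight w) :: complex)" for w :: "('n \<times> 'n) list"
  define s where "s a b = (\<lambda>w. of_int (if a = b then (weight a w)\<^sup>2
      else if a < b then weight a w - weight b w else 0) * t w)" for a b
  have "tact (mat_unit a b) (tact (mat_unit b a) t) - s a b \<in> U" for a b
  proof (rule linorder_cases [of a b])
    assume "a = b"
    then have "tact (mat_unit a b) (tact (mat_unit b a) t) =
        (\<lambda>w. of_int (weight a w) * tact (mat_unit a a) t w)"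
      using tact_mat_unit_diagonal [OF tact_quadratic [OF tq], of a "mat_unit a a"] by simp
    also have "\<dots> = s a b"
      using \<open>a = b\<close>
      by (simp add: tact_mat_unit_diagonal [OF tq] s_def power2_eq_square mult.assoc)
    finally show ?thesis using sub by (simp add: tensor.subspace_0)
  next
    assume ab: "a < b"
    then have "tact (mat_unit a b) (tact (mat_unit b a) t) - s a b
        = tact (mat_unit b a) (tact (mat_unit a b) t)"
      using tact_mat_unit_commutator [OF tq less_imp_neq [OF ab]] less_imp_neq [OF ab]
      by (simp add: s_def)
    then show ?thesis using submodule_tact [OF assms(1) raise [OF ab]] by simp
  next
    assume ab: "b < a"
    then have "s a b = 0" by (auto simp: s_def fun_eq_iff)
    then show ?thesis using submodule_tact [OF assms(1) raise [OF ab]] by simp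
  qed
  then have "(\<Sum>a\<in>UNIV. \<Sum>b\<in>UNIV. tact (mat_unit a b) (tact (mat_unit b a) t) - s a b) \<in> U"
    by (intro tensor.subspace_sum sub)
  also have "(\<Sum>a\<in>UNIV. \<Sum>b\<in>UNIV. tact (mat_unit a b) (tact (mat_unit b a) t) - s a b)
      = tscale c t - (\<Sum>a\<in>UNIV. \<Sum>b\<in>UNIV. s a b)"
    using casimir_symmetric_traceless [of t] t(1) assms(5)
    by (auto simp: sum_subtractf c_def)
  also have "\<dots> = (\<lambda>w. (c - d w) * t w)"
    by (simp add: fun_eq_iff sum_apply tscale_apply s_def d_def casimir_weight_def
        left_diff_distrib sum_distrib_right)
  finally have cas: "(\<lambda>w. (c - d w) * t w) \<in> U" .
  have md: "multiplier X d" if "submodule X" "X \<subseteq> quadratic" for X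
  proof -
    note w = multiplier_weight [OF that]
    have sub: "tensor.subspace X" by (rule submodule_subspace [OF that(1)])
    have "multiplier X (\<lambda>w. \<Sum>a\<in>UNIV. \<Sum>b\<in>UNIV.
        if a = b then of_int (weight a w) * of_int (weight a w)
        else if a < b then of_int (weight a w) - of_int (weight b w) else 0)"
    proof (intro multiplier_sum sub)
      fix a b
      show "multiplier X (\<lambda>w. if a = b then of_int (weight a w) * of_int (weight a w)
          else if a < b then of_int (weight a w) - of_int (weight b w) else 0)"
        by (cases "a = b"; cases "a < b")
          (simp_all add: sub w multiplier_mult multiplier_diff multiplier_const)
    qed
    also have "(\<lambda>w. \<Sum>a\<in>UNIV. \<Sum>b\<in>UNIV.
        if a = b then of_int (weight a w) * of_int (weight a w)
        else if a < b then of_int (weight a w) - of_int (weight b w) else 0) = d"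
      by (auto simp: d_def casimir_weight_def fun_eq_iff power2_eq_square intro!: sum.cong)
    finally show ?thesis .
  qed
  have "multiplier U (\<lambda>w. if d w = c then 0 else 1 / (c - d w))"
    by (rule multiplier_compose [where \<phi> = "\<lambda>x. if x = c then 0 else 1 / (c - x)"])
      (simp_all add: sub q md assms)
  then have "(\<lambda>w. (if d w = c then 0 else 1 / (c - d w)) * ((c - d w) * t w)) \<in> U"
    using cas by (simp add: multiplier_def)
  also have "(\<lambda>w. (if d w = c then 0 else 1 / (c - d w)) * ((c - d w) * t w))
      = (\<lambda>w. if d w = c then 0 else t w)"
    by auto
  finally have rest: "(\<lambda>w. if d w = c then 0 else t w) \<in> U" (is "?r \<in> U") .
  have top: "w = top_word" if "d w = c" "length w = 2" for w
  proof -
    have "(of_int (casimir_weight w) :: complex) = of_int (4 * int CARD('n) + 4)"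
      using that by (simp add: d_def c_def)
    then show ?thesis using casimir_weight_top that by (metis of_int_eq_iff)
  qed
  have "d top_word = c"
  proof (rule ccontr)
    assume "d top_word \<noteq> c"
    then have "?r = t" using top tq by (fastforce simp: quadratic_def)
    then show False using rest t by simp
  qed
  have split: "?r = t - tscale (t top_word) top_tensor"
  proof
    fix w
    consider "w = top_word" | "d w \<noteq> c" "w \<noteq> top_word" | "length w \<noteq> 2" "w \<noteq> top_word"
      using top by blast
    then show "?r w = (t - tscale (t top_word) top_tensor) w"
    proof cases
      case 1
      show ?thesis unfolding 1 using \<open>d top_word = c\<close> by (simp add: tscale_apply top_tensor_apply)
    next
      case 2
      then show ?thesis by (simp add: tscale_apply top_tensor_apply)
    next
      case 3
      then show ?thesis using tq by (simp add: tscale_apply top_tensor_apply quadratic_def)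
    qed
  qed
  have tt: "tscale (t top_word) top_tensor \<in> Z"
  proof -
    have "t - ?r \<in> Z" using t(1) rest assms(3) sub(2) by (intro tensor.subspace_diff) auto
    then show ?thesis unfolding split by simp
  qed
  show notU: "top_tensor \<notin> U"
  proof
    assume "top_tensor \<in> U"
    then have "?r + tscale (t top_word) top_tensor \<in> U"
      using rest sub by (intro tensor.subspace_add tensor.subspace_scale)
    then show False using t unfolding split by simp
  qed
  have "t top_word \<noteq> 0"
  proof
    assume "t top_word = 0"
    then have "?r = t" unfolding split by simp
    then show False using rest t by simp
  qed
  then have "top_tensor = tscale (1 / t top_word) (tscale (t top_word) top_tensor)"
    by (simp add: fun_eq_iff tscale_apply)
  then show "top_tensor \<in> Z"
    using tensor.subspace_scale [OF sub(2) tt] by metis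
qed

lemma Min_neq_Max:
  assumes "CARD('n) \<ge> 2"
  shows "Min (UNIV :: 'n::{finite, linorder} set) \<noteq> Max UNIV"
proof
  assume eq: "Min (UNIV :: 'n set) = Max UNIV"
  have "x = Max UNIV" for x :: 'n
    using Min_le [of UNIV x] Max_ge [of UNIV x] unfolding eq by (intro antisym) auto
  then have "(UNIV :: 'n set) = {Max UNIV}" by blast
  then have "CARD('n) = 1" by (metis card_1_singleton_iff One_nat_def)
  then show False using assms by simp
qed

lemma top_tensor_symmetric_traceless:
  assumes "CARD('n) \<ge> 2"
  shows "top_tensor \<in> (symmetric_traceless :: 'n::{finite, linorder} tensor set)"
proof -
  show ?thesis
    using Min_neq_Max [OF assms]
    by (auto simp: symmetric_traceless_def top_tensor_apply quadratic_def intro!: sum.neutral)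
qed

text \<open>If \<open>U\<close> were neither zero nor everything, the inclusions of zero in \<open>U\<close> and of \<open>U\<close> in the whole
  space would put \<open>top_tensor\<close> both inside and outside \<open>U\<close>.\<close>

lemma irreducible_symmetric_traceless:
  assumes "CARD('n) \<ge> 2"
  shows "irreducible_module (symmetric_traceless :: 'n::{finite, linorder} tensor set)"
  unfolding irreducible_module_def
proof (intro conjI allI impI)
  have zero: "submodule {0 :: 'n tensor}"
    by (simp add: submodule_def tensor.subspace_single_0 tact_zero)
  show "submodule (symmetric_traceless :: 'n tensor set)"
    by (rule submodule_symmetric_traceless)
  have "(top_tensor :: 'n tensor) \<noteq> 0"
    by (auto simp: fun_eq_iff top_tensor_apply)
  then show "symmetric_traceless \<noteq> {0 :: 'n tensor}"
    using top_tensor_symmetric_traceless [OF assms] by blast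
  fix U :: "'n tensor set" assume U: "submodule U \<and> U \<subseteq> symmetric_traceless"
  then have sub: "{0} \<subseteq> U"
    by (simp add: tensor.subspace_0 submodule_subspace)
  show "U = {0} \<or> U = symmetric_traceless"
    using top_tensor_in_difference(1) [OF zero _ sub]
      top_tensor_in_difference(2) [OF _ submodule_symmetric_traceless, of U] U
    by blast
qed

section \<open>Identification of the Cartan square\<close>

text \<open>The coroot of the highest root. It separates the weight of \<open>top_tensor\<close>, where it has the value
  \<open>4\<close>, from the weights of all other words of length two.\<close>

definition top_cartan :: "'n::{finite, linorder} cmat" where
  "top_cartan = mat_unit (Min UNIV) (Min UNIV) - mat_unit (Max UNIV) (Max UNIV)"

lemma top_cartan: "top_cartan \<in> cartan_subalgebra"
  by (simp add: top_cartan_def cartan_subalgebra_def sl_def trace_sub trace_mat_unit mat_unit_apply)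

lemma tact_top_cartan_apply:
  assumes "t \<in> quadratic"
  shows "tact top_cartan t = (\<lambda>w. of_int (weight (Min UNIV) w - weight (Max UNIV) w) * t w)"
proof -
  have e: "top_cartan = mat_unit (Min UNIV) (Min UNIV)
      + mscale (- 1) (mat_unit (Max UNIV) (Max UNIV))"
    by (simp add: top_cartan_def vec_eq_iff mscale_apply)
  show ?thesis
    unfolding e tact_add_matrix tact_scale_matrix
    by (simp add: tact_mat_unit_diagonal assms fun_eq_iff tscale_apply algebra_simps)
qed

lemma top_weight:
  assumes "CARD('n) \<ge> 2" "length w = 2"
    and "weight (Min UNIV) w - weight (Max UNIV) w = 4"
  shows "w = (top_word :: ('n::{finite, linorder} \<times> 'n) list)"
proof -
  obtain i j k l where w: "w = [(i, j), (k, l)]"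
    using assms(2) by (rule length_2_cases)
  show ?thesis
    using assms(3) Min_neq_Max [OF assms(1)]
    by (auto simp: w weight_2 of_bool_def split: if_splits)
qed

lemma top_component:
  fixes U :: "'n::{finite, linorder} tensor set"
  assumes "CARD('n) \<ge> 2" "submodule U" "U \<subseteq> quadratic" "t \<in> U"
  shows "tscale (t top_word) top_tensor \<in> U"
proof -
  define d where "d w = (of_int (weight (Min UNIV) w - weight (Max UNIV) w) :: complex)"
    for w :: "('n \<times> 'n) list"
  have "multiplier U d"
    unfolding multiplier_def
  proof
    fix u assume u: "u \<in> U"
    then have "tact top_cartan u = (\<lambda>w. d w * u w)"
      using tact_top_cartan_apply [of u] assms(3) unfolding d_def by blast
    then show "(\<lambda>w. d w * u w) \<in> U"
      using submodule_tact [OF assms(2) u, of top_cartan] by simp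
  qed
  then have "multiplier U (\<lambda>w. if d w = 4 then 1 else 0)"
    by (intro multiplier_compose [where \<phi> = "\<lambda>x. if x = 4 then 1 else 0"] assms
        submodule_subspace)
  then have "(\<lambda>w. (if d w = 4 then 1 else 0) * t w) \<in> U"
    using assms(4) by (simp add: multiplier_def)
  also have "(\<lambda>w. (if d w = 4 then 1 else 0) * t w) = tscale (t top_word) top_tensor"
  proof
    fix w :: "('n \<times> 'n) list"
    consider "w = top_word" | "w \<noteq> top_word" "length w \<noteq> 2" | "w \<noteq> top_word" "length w = 2"
      by blast
    then show "(if d w = 4 then 1 else 0) * t w = tscale (t top_word) top_tensor w"
    proof cases
      case 1
      have "d top_word = 4"
        using Min_neq_Max [OF assms(1)] by (simp add: d_def weight_2)
      then show ?thesis unfolding 1 by (simp add: tscale_apply top_tensor_apply)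
    next
      case 2
      then have "t w = 0" using assms(3,4) by (auto simp: quadratic_def)
      then show ?thesis using 2 by (simp add: tscale_apply top_tensor_apply)
    next
      case 3
      then have "weight (Min UNIV) w - weight (Max UNIV) w \<noteq> 4"
        using top_weight [OF assms(1)] by blast
      then have "d w \<noteq> 4" unfolding d_def by (metis of_int_eq_iff of_int_numeral)
      then show ?thesis using 3 by (simp add: tscale_apply top_tensor_apply)
    qed
  qed
  finally show ?thesis .
qed

lemma bracket_mat_unit_left_apply:
  "bracket (mat_unit a b) A $ i $ j =
     (if i = a then A $ b $ j else 0) - (if j = b then A $ i $ a else 0)"
  by (simp add: bracket_nth mat_unit_apply sum_subtractf mult_delta_left mult_delta_right
      if_distrib [of "\<lambda>x. _ * x"] cong: if_cong)

lemma bracket_mat_unit_right_apply: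
  "bracket A (mat_unit a b) $ i $ j =
     (if j = b then A $ i $ a else 0) - (if i = a then A $ b $ j else 0)"
proof -
  have "bracket A (mat_unit a b) = - bracket (mat_unit a b) A" by (simp add: bracket_def)
  then show ?thesis by (simp add: bracket_mat_unit_left_apply)
qed

text \<open>Commuting with the matrix units above the diagonal kills all entries off the upper right corner,
  except that the diagonal entries are equal; they vanish because the trace does.\<close>

lemma highest_weight_sl:
  fixes \<mu> :: "'n::{finite, linorder} cmat \<Rightarrow> complex"
  assumes "CARD('n) \<ge> 2" "highest_weight mscale bracket sl \<mu>"
  shows "\<mu> top_cartan = 2"
proof -
  let ?lo = "Min (UNIV :: 'n set)" and ?hi = "Max (UNIV :: 'n set)"
  obtain A where A: "A \<in> sl" "A \<noteq> 0"
    and pos: "\<And>N. N \<in> positive_part \<Longrightarrow> bracket N A = 0"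
    and wt: "\<And>H. H \<in> cartan_subalgebra \<Longrightarrow> bracket H A = mscale (\<mu> H) A"
    using assms(2) unfolding highest_weight_def by blast
  have E: "(if i = a then A $ b $ j else 0) = (if j = b then A $ i $ a else 0)"
    if "a < b" for a b i j
  proof -
    have "bracket (mat_unit a b) A = 0"
      using that by (intro pos) (auto simp: positive_part_def mat_unit_apply)
    then have "bracket (mat_unit a b) A $ i $ j = 0" by simp
    then show ?thesis
      by (simp add: bracket_mat_unit_left_apply)
  qed
  have lo: "?lo < b" if "b \<noteq> ?lo" for b using that Min_le [of UNIV b] by (simp add: le_less)
  have hi: "a < ?hi" if "a \<noteq> ?hi" for a using that Max_ge [of UNIV a] by (simp add: le_less)
  have row: "A $ b $ j = 0" if "b \<noteq> ?lo" "j \<noteq> b" for b j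
    using E [OF lo [OF that(1)], of ?lo j] that by (simp split: if_splits)
  have col: "A $ i $ a = 0" if "a \<noteq> ?hi" "i \<noteq> a" for i a
    using E [OF hi [OF that(1)], of i ?hi] that by (simp split: if_splits)
  have diag: "A $ b $ b = A $ ?lo $ ?lo" for b
    using E [of ?lo b ?lo b] lo [of b] by (cases "b = ?lo") auto
  have "(\<Sum>b\<in>UNIV. A $ b $ b) = 0" using A(1) by (simp add: sl_def trace_def)
  also have "(\<Sum>b\<in>UNIV. A $ b $ b) = (\<Sum>b\<in>(UNIV :: 'n set). A $ ?lo $ ?lo)"
    by (rule sum.cong [OF refl diag])
  finally have "A $ ?lo $ ?lo = 0" by simp
  then have diag0: "A $ b $ b = 0" for b using diag [of b] by metis
  have top: "A $ ?lo $ ?hi \<noteq> 0"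
  proof
    assume "A $ ?lo $ ?hi = 0"
    then have "A $ i $ j = 0" for i j
      using row [of i j] col [of j i] diag0 by (cases "i = j"; cases "i = ?lo"; cases "j = ?hi") auto
    then show False using A(2) by (simp add: vec_eq_iff)
  qed
  have "bracket top_cartan A $ ?lo $ ?hi = 2 * A $ ?lo $ ?hi"
    using Min_neq_Max [OF assms(1)]
    by (simp add: top_cartan_def bracket_diff_left bracket_mat_unit_left_apply)
  then have "\<mu> top_cartan * A $ ?lo $ ?hi = 2 * A $ ?lo $ ?hi"
    using wt [OF top_cartan] by (simp add: mscale_apply)
  then show ?thesis using top by simp
qed

lemma highest_weight_exists:
  assumes "CARD('n) \<ge> 2"
  defines "\<mu> \<equiv> \<lambda>H :: 'n::{finite, linorder} cmat. H $ Min UNIV $ Min UNIV - H $ Max UNIV $ Max UNIV"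
  shows "highest_weight mscale bracket sl \<mu>"
    and "highest_weight tscale tact symmetric_traceless (\<lambda>H. 2 * \<mu> H)"
proof -
  let ?lo = "Min (UNIV :: 'n set)" and ?hi = "Max (UNIV :: 'n set)"
  let ?E = "mat_unit ?lo ?hi"
  have E0: "?E \<noteq> 0"
    by (auto simp: vec_eq_iff mat_unit_apply)
  have E: "?E \<in> sl" using Min_neq_Max [OF assms(1)] by (simp add: sl_def trace_mat_unit)
  have pos: "bracket A ?E = 0" if "A \<in> positive_part" for A
  proof -
    have "A $ i $ ?lo = 0" "A $ ?hi $ j = 0" for i j
      using that by (auto simp: positive_part_def)
    then show ?thesis
      by (simp add: vec_eq_iff bracket_mat_unit_right_apply)
  qed
  have wt: "bracket H ?E = mscale (\<mu> H) ?E" if "H \<in> cartan_subalgebra" for H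
  proof -
    have 0: "H $ i $ j = 0" if "i \<noteq> j" for i j
      using \<open>H \<in> cartan_subalgebra\<close> that by (simp add: cartan_subalgebra_def)
    have "bracket H ?E $ i $ j = mscale (\<mu> H) ?E $ i $ j" for i j
      using 0 [of i ?lo] 0 [of ?hi j]
      by (auto simp: bracket_mat_unit_right_apply mat_unit_apply mscale_apply \<mu>_def)
    then show ?thesis by (simp add: vec_eq_iff)
  qed
  show "highest_weight mscale bracket sl \<mu>"
    unfolding highest_weight_def using E E0 pos wt by blast
  have "tact A top_tensor = 0" if "A \<in> positive_part" for A :: "'n cmat"
    by (simp add: top_tensor_def tact_pure_2 pos [OF that] pure_2_zero)
  moreover have "tact H top_tensor = tscale (2 * \<mu> H) top_tensor" if "H \<in> cartan_subalgebra"
    for H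
  proof -
    have "pure [mscale c ?E, ?E] + pure [?E, mscale c ?E] = tscale (2 * c) (pure [?E, ?E])" for c
      by (rule quadratic_eqI) (simp_all add: quadratic_def pure_eq_0 mscale_apply tscale_apply)
    then show ?thesis by (simp add: top_tensor_def tact_pure_2 wt [OF that])
  qed
  moreover have "top_tensor \<noteq> (0 :: 'n tensor)" by (auto simp: fun_eq_iff top_tensor_apply)
  ultimately show "highest_weight tscale tact symmetric_traceless (\<lambda>H. 2 * \<mu> H)"
    unfolding highest_weight_def using top_tensor_symmetric_traceless [OF assms(1)] by blast
qed

lemma submodule_Int: "submodule U \<Longrightarrow> submodule W \<Longrightarrow> submodule (U \<inter> W)"
  by (simp add: submodule_def tensor.subspace_inter)

text \<open>An irreducible submodule with the prescribed weight has a vector of value \<open>4\<close> for \<open>top_cartan\<close>, so it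
  contains \<open>top_tensor\<close> and meets the irreducible space of symmetric traceless tensors.\<close>

lemma cartan_square_eq:
  assumes "CARD('n) \<ge> 2"
  shows "cartan_square = (symmetric_traceless :: 'n::{finite, linorder} tensor set)"
  unfolding cartan_square_def
proof (rule the_equality)
  show "symmetric_traceless \<subseteq> tensor_power 2 sl \<and>
      irreducible_module (symmetric_traceless :: 'n tensor set) \<and>
      (\<exists>\<mu>. highest_weight mscale bracket sl \<mu> \<and>
        highest_weight tscale tact (symmetric_traceless :: 'n tensor set) (\<lambda>H. 2 * \<mu> H))"
    using symmetric_traceless_subset irreducible_symmetric_traceless highest_weight_exists assms
    by blast
next
  fix W :: "'n tensor set"
  assume W: "W \<subseteq> tensor_power 2 sl \<and> irreducible_module W \<and>
      (\<exists>\<mu>. highest_weight mscale bracket sl \<mu> \<and> highest_weight tscale tact W (\<lambda>H. 2 * \<mu> H))"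
  then obtain \<mu> where \<mu>: "highest_weight mscale bracket sl \<mu>"
    and hw: "highest_weight tscale tact W (\<lambda>H. 2 * \<mu> H)" by blast
  have irr: "submodule W" "\<And>U. submodule U \<Longrightarrow> U \<subseteq> W \<Longrightarrow> U = {0} \<or> U = W"
    using W by (auto simp: irreducible_module_def)
  have q: "W \<subseteq> quadratic" using W tensor_power_2_sl by blast
  obtain v where v: "v \<in> W" "v \<noteq> 0" "tact top_cartan v = tscale (2 * \<mu> top_cartan) v"
    using hw top_cartan by (auto simp: highest_weight_def)
  have vq: "v \<in> quadratic" using v q by blast
  have "w = top_word" if "v w \<noteq> 0" for w
  proof (rule top_weight [OF assms])
    show "length w = 2" using that vq by (auto simp: quadratic_def)
    have "tact top_cartan v w = 4 * v w"
      using v(3) highest_weight_sl [OF assms \<mu>] by (simp add: tscale_apply)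
    then have "of_int (weight (Min UNIV) w - weight (Max UNIV) w) = (of_int 4 :: complex)"
      using that by (simp add: tact_top_cartan_apply [OF vq])
    then show "weight (Min UNIV) w - weight (Max UNIV) w = 4" by (simp only: of_int_eq_iff)
  qed
  then have "v top_word \<noteq> 0" using v(2) by (auto simp: fun_eq_iff)
  then have "top_tensor = tscale (1 / v top_word) (tscale (v top_word) top_tensor)"
    by (simp add: fun_eq_iff tscale_apply)
  moreover have "tscale (v top_word) top_tensor \<in> W"
    by (rule top_component [OF assms irr(1) q v(1)])
  ultimately have "top_tensor \<in> W"
    using tensor.subspace_scale [OF submodule_subspace [OF irr(1)]] by metis
  then have "top_tensor \<in> W \<inter> symmetric_traceless" "top_tensor \<noteq> (0 :: 'n tensor)"
    using top_tensor_symmetric_traceless [OF assms] by (auto simp: fun_eq_iff top_tensor_apply)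
  then have "W \<inter> symmetric_traceless \<noteq> {0}" by blast
  moreover have "submodule (W \<inter> symmetric_traceless)"
    by (rule submodule_Int [OF irr(1) submodule_symmetric_traceless])
  ultimately have "W \<inter> symmetric_traceless = W" "W \<inter> symmetric_traceless = symmetric_traceless"
    using irr(2) irreducible_symmetric_traceless [OF assms] unfolding irreducible_module_def
    by (metis Int_lower1, metis Int_lower2)
  then show "W = symmetric_traceless" by simp
qed

section \<open>The invariant projection\<close>

definition symmetrize :: "'n tensor \<Rightarrow> 'n tensor" where
  "symmetrize t = (\<lambda>w. case w of
       [(i, j), (k, l)] \<Rightarrow> (t [(i, j), (k, l)] + t [(k, j), (i, l)]
         + t [(i, l), (k, j)] + t [(k, l), (i, j)]) / 4
     | _ \<Rightarrow> 0)"

lemma symmetrize_apply: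
  "symmetrize t [(i, j), (k, l)] =
     (t [(i, j), (k, l)] + t [(k, j), (i, l)] + t [(i, l), (k, j)] + t [(k, l), (i, j)]) / 4"
  by (simp add: symmetrize_def)

lemma symmetrize_quadratic: "symmetrize t \<in> quadratic"
  by (auto simp: quadratic_def symmetrize_def split: list.split)

lemma symmetrize_add: "symmetrize (t + u) = symmetrize t + symmetrize u"
  and symmetrize_diff: "symmetrize (t - u) = symmetrize t - symmetrize u"
  and symmetrize_scale: "symmetrize (tscale c t) = tscale c (symmetrize t)"
  by (auto simp: fun_eq_iff symmetrize_def tscale_apply add_divide_distrib diff_divide_distrib
      algebra_simps split: list.split)

lemma symmetrize_tact:
  "symmetrize (tact A t) = tact A (symmetrize t)"
proof (rule quadratic_eqI)
  show "symmetrize (tact A t) [(i, j), (k, l)] = tact A (symmetrize t) [(i, j), (k, l)]"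
    for i j k l
    by (simp add: symmetrize_apply tact_apply_2 sum.distrib sum_divide_distrib [symmetric]
        distrib_left distrib_right)
      (simp add: field_simps)
qed (simp_all add: symmetrize_quadratic tact_quadratic)

lemma partial_trace_add: "partial_trace (t + u) = partial_trace t + partial_trace u"
  and partial_trace_diff: "partial_trace (t - u) = partial_trace t - partial_trace u"
  and partial_trace_scale: "partial_trace (tscale c t) = mscale c (partial_trace t)"
  by (simp_all add: partial_trace_def vec_eq_iff sum.distrib sum_subtractf tscale_apply
      mscale_apply sum_distrib_left)

lemma partial_trace_tact: "partial_trace (tact A t) = bracket A (partial_trace t)"
  by (simp add: vec_eq_iff sum_tact_trace [symmetric]) (simp add: partial_trace_def)

lemma partial_trace_symmetrize_identity:
  "partial_trace (symmetrize (pure [mat 1, M :: 'n::finite cmat])) =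
     mscale (1 / 4) (mscale (of_nat CARD('n) + 2) M + mscale (trace M) (mat 1))"
  by (simp add: vec_eq_iff partial_trace_def symmetrize_apply mscale_apply mat_def trace_def
      sum.distrib sum_divide_distrib [symmetric] mult_delta_left mult_delta_right distrib_right
      if_distrib [of "\<lambda>x. x * _"] cong: if_cong)

text \<open>The matrix \<open>M\<close> for which the partial trace of the symmetrization of \<open>I \<otimes> M\<close>, with \<open>I\<close> the
  identity matrix, equals \<open>\<tau>\<close>. The equation is \<open>(n + 2) M + (tr M) I = 4 \<tau>\<close>; its trace determines
  \<open>tr M\<close>, and then it determines \<open>M\<close>.\<close>

definition trace_correction :: "'n::finite tensor \<Rightarrow> 'n cmat" where
  "trace_correction t = (let \<tau> = partial_trace (symmetrize t); n = of_nat CARD('n)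
     in mscale (4 / (n + 2)) \<tau> - mscale (2 * trace \<tau> / ((n + 1) * (n + 2))) (mat 1))"

definition cartan_projection :: "'n::finite tensor \<Rightarrow> 'n tensor" where
  "cartan_projection t = symmetrize (t - pure [mat 1, trace_correction t])"

lemma pure_2_bilinear:
  shows pure_2_add_left: "pure [X + X', Y] = pure [X, Y] + pure [X', Y]"
    and pure_2_add_right: "pure [X, Y + Y'] = pure [X, Y] + pure [X, Y']"
    and pure_2_diff_left: "pure [X - X', Y] = pure [X, Y] - pure [X', Y]"
    and pure_2_diff_right: "pure [X, Y - Y'] = pure [X, Y] - pure [X, Y']"
    and pure_2_scale_left: "pure [mscale c X, Y] = tscale c (pure [X, Y])"
    and pure_2_scale_right: "pure [X, mscale c Y] = tscale c (pure [X, Y])"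
  by (rule quadratic_eqI;
      simp add: quadratic_def pure_eq_0 mscale_apply tscale_apply algebra_simps)+

lemma card_plus_nonzero:
  "of_nat CARD('n::finite) + 1 \<noteq> (0 :: complex)" "of_nat CARD('n::finite) + 2 \<noteq> (0 :: complex)"
  using of_nat_neq_0 [of "CARD('n)", where ?'a = complex]
    of_nat_neq_0 [of "CARD('n) + 1", where ?'a = complex]
  by (simp_all add: add.commute)

lemma trace_correction_add: "trace_correction (t + u) = trace_correction t + trace_correction u"
  by (simp add: trace_correction_def Let_def symmetrize_add partial_trace_add trace_add
      vec_eq_iff mscale_apply add_divide_distrib algebra_simps)

lemma trace_correction_scale: "trace_correction (tscale c t) = mscale c (trace_correction t)"
  by (simp add: trace_correction_def Let_def symmetrize_scale partial_trace_scale trace_mscale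
      vec_eq_iff mscale_apply algebra_simps)

lemma trace_bracket: "trace (bracket A B) = 0"
  using bracket_sl by (auto simp: sl_def)

lemma trace_correction_tact: "trace_correction (tact A t) = bracket A (trace_correction t)"
  by (simp add: trace_correction_def Let_def symmetrize_tact partial_trace_tact trace_bracket
      bracket_diff_right bracket_scale_right bracket_identity)

lemma cartan_projection_add:
  "cartan_projection (t + u) = cartan_projection t + cartan_projection u"
  by (simp add: cartan_projection_def trace_correction_add pure_2_add_right symmetrize_add
      symmetrize_diff)

lemma cartan_projection_scale:
  "cartan_projection (tscale c t) = tscale c (cartan_projection t)"
  by (simp add: cartan_projection_def trace_correction_scale pure_2_scale_right symmetrize_scale
      symmetrize_diff tensor.scale_right_diff_distrib)

lemma cartan_projection_diff:
  "cartan_projection (t - u) = cartan_projection t - cartan_projection u"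
proof -
  have "t - u = t + tscale (- 1) u" by (simp add: fun_eq_iff tscale_apply)
  then have "cartan_projection (t - u) = cartan_projection t + tscale (- 1) (cartan_projection u)"
    by (simp only: cartan_projection_add cartan_projection_scale)
  then show ?thesis by (simp add: fun_eq_iff tscale_apply)
qed

lemma cartan_projection_tact: "cartan_projection (tact A t) = tact A (cartan_projection t)"
proof -
  have diff: "tact A (t - u) = tact A t - tact A u" for u
  proof -
    have "tact A t = tact A ((t - u) + u)" by simp
    then show ?thesis unfolding tact_add by simp
  qed
  have "tact A (pure [mat 1, trace_correction t]) = pure [mat 1, bracket A (trace_correction t)]"
    by (simp add: tact_pure_2 bracket_identity pure_2_zero)
  then show ?thesis
    by (simp add: cartan_projection_def trace_correction_tact symmetrize_tact [symmetric] diff)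
qed

lemma cartan_projection_eqI:
  "symmetrize t = symmetrize u \<Longrightarrow> cartan_projection t = cartan_projection u"
  by (simp add: cartan_projection_def trace_correction_def symmetrize_diff)

lemma cartan_projection_in: "cartan_projection (t :: 'n::finite tensor) \<in> symmetric_traceless"
proof -
  let ?n = "of_nat CARD('n) :: complex"
  define \<tau> where "\<tau> = partial_trace (symmetrize t)"
  define M where "M = trace_correction t"
  have n: "?n + 1 \<noteq> 0" "?n + 2 \<noteq> 0"
    by (rule card_plus_nonzero)+
  have M: "M = mscale (4 / (?n + 2)) \<tau> - mscale (2 * trace \<tau> / ((?n + 1) * (?n + 2))) (mat 1)"
    by (simp add: M_def \<tau>_def trace_correction_def Let_def)
  have trM: "trace M = 2 * trace \<tau> / (?n + 1)"
  proof -
    have "trace M = 4 / (?n + 2) * trace \<tau> - 2 * trace \<tau> / ((?n + 1) * (?n + 2)) * ?n"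
      by (simp add: M trace_sub trace_mscale trace_identity)
    also have "\<dots> = 2 * trace \<tau> / (?n + 1)"
      using n by (simp add: divide_simps) (simp add: algebra_simps)
    finally show ?thesis .
  qed
  have "partial_trace (cartan_projection t) =
      \<tau> - mscale (1 / 4) (mscale (?n + 2) M + mscale (trace M) (mat 1))"
    by (simp add: cartan_projection_def symmetrize_diff partial_trace_diff \<tau>_def M_def
        partial_trace_symmetrize_identity)
  also have "\<dots> = 0"
    unfolding trM unfolding M
    using n by (simp add: vec_eq_iff mscale_apply divide_simps)
  finally have "(\<Sum>i\<in>UNIV. cartan_projection t [(i, i), (k, l)]) = 0" for k l
    by (simp add: partial_trace_def vec_eq_iff)
  then show ?thesis
    by (simp add: symmetric_traceless_def cartan_projection_def symmetrize_quadratic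
        symmetrize_apply algebra_simps)
qed

lemma symmetrize_symmetric_traceless: "t \<in> symmetric_traceless \<Longrightarrow> symmetrize t = t"
proof (rule quadratic_eqI)
  assume t: "t \<in> symmetric_traceless"
  then show "t \<in> quadratic" by (rule symmetric_traceless_quadratic)
  fix i j k l
  have "t [(k, j), (i, l)] = t [(i, j), (k, l)]" "t [(i, l), (k, j)] = t [(i, j), (k, l)]"
     "t [(k, l), (i, j)] = t [(i, l), (k, j)]"
    using t unfolding symmetric_traceless_def by blast+
  then show "symmetrize t [(i, j), (k, l)] = t [(i, j), (k, l)]"
    by (simp add: symmetrize_apply)
qed (rule symmetrize_quadratic)

lemma cartan_projection_id:
  assumes "t \<in> symmetric_traceless"
  shows "cartan_projection t = t"
proof -
  have "partial_trace t = 0"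
    by (simp add: partial_trace_def vec_eq_iff symmetric_traceless_traces [OF assms])
  moreover have "trace (0 :: 'a cmat) = 0" by (simp add: trace_def)
  ultimately have "trace_correction t = mscale 0 0 - mscale 0 (mat 1)"
    unfolding trace_correction_def Let_def symmetrize_symmetric_traceless [OF assms]
    by (simp add: cmat.scale_zero_left cmat.scale_zero_right)
  then have "pure [mat 1, trace_correction t] = 0"
    by (simp add: cmat.scale_zero_left pure_2_zero)
  then show ?thesis
    by (simp add: cartan_projection_def symmetrize_symmetric_traceless [OF assms])
qed

lemma cartan_projection_identity_left: "cartan_projection (pure [mat 1, Y :: 'n::finite cmat]) = 0"
proof -
  let ?n = "of_nat CARD('n) :: complex"
  have n: "?n + 1 \<noteq> 0" "?n + 2 \<noteq> 0"
    by (rule card_plus_nonzero)+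
  define \<tau> where "\<tau> = partial_trace (symmetrize (pure [mat 1, Y]))"
  have \<tau>: "\<tau> = mscale (1 / 4) (mscale (?n + 2) Y + mscale (trace Y) (mat 1))"
    unfolding \<tau>_def by (rule partial_trace_symmetrize_identity)
  then have "trace \<tau> = 1 / 4 * ((?n + 2) * trace Y + trace Y * ?n)"
    by (simp add: trace_mscale trace_add trace_identity)
  then have "2 * trace \<tau> = (?n + 1) * trace Y" by (simp add: algebra_simps)
  then have "2 * trace \<tau> / ((?n + 1) * (?n + 2)) = trace Y / (?n + 2)" using n by simp
  then have "trace_correction (pure [mat 1, Y]) = mscale (4 / (?n + 2)) \<tau> - mscale (trace Y / (?n + 2)) (mat 1)"
    by (simp add: trace_correction_def Let_def \<tau>_def)
  also have "\<dots> = Y"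
  proof -
    have "4 / N * (1 / 4) * (N * y + z * e) - z / N * e = y" if "N \<noteq> 0" for N y z e :: complex
      using that by (simp add: field_simps)
    from this [OF n(2)] show ?thesis
      by (simp add: \<tau> vec_eq_iff mscale_apply del: times_divide_eq_left times_divide_eq_right)
  qed
  finally show ?thesis
    by (simp add: cartan_projection_def) (simp add: symmetrize_def fun_eq_iff split: list.split)
qed

lemma cartan_projection_swap: "cartan_projection (pure [X, Y]) = cartan_projection (pure [Y, X])"
  by (intro cartan_projection_eqI quadratic_eqI symmetrize_quadratic)
    (simp add: symmetrize_apply)

lemma cartan_projection_identity_right: "cartan_projection (pure [X, mat 1]) = 0"
  using cartan_projection_identity_left cartan_projection_swap by metis

text \<open>Tensors with a factor \<open>mat 1\<close> are killed, so that the projection can be evaluated on matrix units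
  although those on the diagonal are not traceless.\<close>

lemma cartan_projection_traceless_part:
  "cartan_projection (pure [traceless_part X, traceless_part Y]) = cartan_projection (pure [X, Y])"
  by (simp add: traceless_part_def pure_2_bilinear cartan_projection_diff cartan_projection_scale
      cartan_projection_identity_left cartan_projection_identity_right)

text \<open>The source of the relations between minors: exchanging the row indices does not change the symmetrization.\<close>

lemma cartan_projection_mat_unit_exchange:
  "cartan_projection (pure [mat_unit i j, mat_unit k l])
     = cartan_projection (pure [mat_unit k j, mat_unit i l])"
  by (intro cartan_projection_eqI quadratic_eqI symmetrize_quadratic)
    (auto simp: symmetrize_apply mat_unit_apply)

lemma invariant_projection_cartan_projection:
  "invariant_projection (tensor_power 2 sl) symmetric_traceless cartan_projection"
  by (simp add: invariant_projection_def cartan_projection_in cartan_projection_id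
      cartan_projection_add cartan_projection_scale cartan_projection_tact)

text \<open>Let \<open>N\<close> be the kernel of \<open>cartan_projection\<close>; its elements have coordinate zero at the top word. If \<open>P\<close>
  did not vanish on \<open>N\<close>, irreducibility would give \<open>u\<close> in \<open>N\<close> with \<open>P u = top_tensor\<close>. The graph of \<open>P\<close> on
  \<open>N\<close>, embedded as the submodule of all \<open>u + P u\<close>, would then contain the weight component
  \<open>top_tensor\<close> of \<open>u + P u\<close>, which forces \<open>v + P v = top_tensor\<close> for some \<open>v\<close> in \<open>N\<close>. Projecting gives
  \<open>P v = top_tensor\<close>, hence \<open>v = 0\<close>, which is absurd.\<close>

lemma invariant_projection_unique:
  fixes P :: "'n::{finite, linorder} tensor \<Rightarrow> 'n tensor"
  assumes "CARD('n) \<ge> 2"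
    and P: "invariant_projection (tensor_power 2 sl) symmetric_traceless P"
    and t: "t \<in> tensor_power 2 sl"
  shows "P t = cartan_projection t"
proof -
  let ?M = "tensor_power 2 sl :: 'n tensor set"
  let ?W = "symmetric_traceless :: 'n tensor set"
  have in_W: "P u \<in> ?W" and add: "v \<in> ?M \<Longrightarrow> P (u + v) = P u + P v"
    and scale: "P (tscale c u) = tscale c (P u)" and inv: "A \<in> sl \<Longrightarrow> P (tact A u) = tact A (P u)"
    if "u \<in> ?M" for u v c A
    using P that unfolding invariant_projection_def by blast+
  have id: "P u = u" if "u \<in> ?W" for u
    using P that unfolding invariant_projection_def by blast
  have subM: "tensor.subspace ?M" by (rule subspace_tensor_power)
  have zero: "P 0 = 0"
    using scale [OF tensor.subspace_0 [OF subM], of 0] by simp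
  define N where "N = {u \<in> ?M. cartan_projection u = 0}"
  have cp0: "cartan_projection 0 = (0 :: 'n tensor)"
    using cartan_projection_scale [of 0 "0 :: 'n tensor"] by simp
  have N: "submodule N"
    unfolding submodule_def
  proof (intro conjI ballI)
    show "tensor.subspace N"
      using subM by (auto intro!: tensor.subspaceI simp: N_def cp0 cartan_projection_add
          cartan_projection_scale tensor.subspace_0 tensor.subspace_add tensor.subspace_scale)
    show "tact A u \<in> N" if "A \<in> sl" "u \<in> N" for A u
      using that submodule_tact [OF submodule_tensor_power_2, of u A]
      by (simp add: N_def cartan_projection_tact tact_zero)
  qed
  have NM: "N \<subseteq> ?M" by (auto simp: N_def)
  have image: "submodule ((\<lambda>u. tscale c u + P u) ` N)" for c
    unfolding submodule_def
  proof (intro conjI ballI)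
    show "tensor.subspace ((\<lambda>u. tscale c u + P u) ` N)"
    proof (rule tensor.subspaceI)
      show "0 \<in> (\<lambda>u. tscale c u + P u) ` N"
        using tensor.subspace_0 [OF submodule_subspace [OF N]] zero
        by (intro image_eqI [of _ _ 0]) auto
    next
      fix x y assume "x \<in> (\<lambda>u. tscale c u + P u) ` N" "y \<in> (\<lambda>u. tscale c u + P u) ` N"
      then obtain u v where "u \<in> N" "x = tscale c u + P u" "v \<in> N" "y = tscale c v + P v"
        by blast
      moreover from this have "x + y = tscale c (u + v) + P (u + v)"
        using add [of u v] subsetD [OF NM] by (simp add: tensor.scale_right_distrib algebra_simps)
      ultimately show "x + y \<in> (\<lambda>u. tscale c u + P u) ` N"
        using tensor.subspace_add [OF submodule_subspace [OF N]] by blast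
    next
      fix a x assume "x \<in> (\<lambda>u. tscale c u + P u) ` N"
      then obtain u where "u \<in> N" "x = tscale c u + P u" by blast
      moreover from this have "tscale a x = tscale c (tscale a u) + P (tscale a u)"
        using scale [of u a] subsetD [OF NM] by (simp add: tensor.scale_right_distrib mult.commute)
      ultimately show "tscale a x \<in> (\<lambda>u. tscale c u + P u) ` N"
        using tensor.subspace_scale [OF submodule_subspace [OF N]] by blast
    qed
    fix A :: "'n cmat" and x
    assume A: "A \<in> sl" and "x \<in> (\<lambda>u. tscale c u + P u) ` N"
    then obtain u where "u \<in> N" "x = tscale c u + P u" by blast
    moreover from this have "tact A x = tscale c (tact A u) + P (tact A u)"
      using inv [of u A] A subsetD [OF NM] by (simp add: tact_add tact_scale)
    ultimately show "tact A x \<in> (\<lambda>u. tscale c u + P u) ` N"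
      using submodule_tact [OF N] by blast
  qed
  have top0: "u top_word = 0" if "u \<in> N" for u
  proof -
    have "cartan_projection u top_word = u top_word"
      using Min_neq_Max [OF assms(1)]
      by (simp add: cartan_projection_def symmetrize_apply mat_def)
    then show ?thesis using that by (simp add: N_def)
  qed
  have top_ne: "(top_tensor :: 'n tensor) \<noteq> 0" by (auto simp: fun_eq_iff top_tensor_apply)
  have "P ` N = {0}"
  proof (rule ccontr)
    assume ne: "P ` N \<noteq> {0}"
    have "submodule (P ` N)" using image [of 0] by simp
    moreover have "P ` N \<subseteq> ?W" using in_W NM by blast
    ultimately have "P ` N = ?W"
      using irreducible_symmetric_traceless [OF assms(1)] ne unfolding irreducible_module_def
      by blast
    then obtain u where u: "u \<in> N" "P u = top_tensor"
      using top_tensor_symmetric_traceless [OF assms(1)] by (metis imageE)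
    define U where "U = (\<lambda>u. tscale 1 u + P u) ` N"
    have "U \<subseteq> ?M"
      using NM in_W symmetric_traceless_subset unfolding U_def
      by (auto intro!: tensor.subspace_add [OF subM])
    then have "U \<subseteq> quadratic" using tensor_power_2_sl by blast
    moreover have "submodule U" unfolding U_def by (rule image)
    moreover have "u + top_tensor \<in> U" using u by (force simp: U_def)
    ultimately have "tscale ((u + top_tensor) top_word) top_tensor \<in> U"
      using top_component [OF assms(1)] by blast
    then have "top_tensor \<in> U" using top0 [OF u(1)] by (simp add: top_tensor_apply)
    then obtain v where v: "v \<in> N" "top_tensor = v + P v" by (auto simp: U_def)
    then have "cartan_projection top_tensor = cartan_projection (v + P v)" by metis
    also have "\<dots> = cartan_projection (P v)"
      using v(1) by (simp add: cartan_projection_add N_def)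
    finally have "cartan_projection top_tensor = cartan_projection (P v)" .
    then have "top_tensor = P v"
      using top_tensor_symmetric_traceless [OF assms(1)] in_W [of v] v(1) NM
      by (auto simp: cartan_projection_id)
    then have "v = 0" using v(2) by simp
    then show False using \<open>top_tensor = P v\<close> zero top_ne by simp
  qed
  moreover have "t - cartan_projection t \<in> N"
    using t cartan_projection_in [of t] symmetric_traceless_subset
    by (auto simp: N_def cartan_projection_diff cartan_projection_id
        intro!: tensor.subspace_diff [OF subM])
  ultimately have "P (t - cartan_projection t) = 0" by blast
  moreover have "P t = P (t - cartan_projection t) + P (cartan_projection t)"
  proof -
    have "cartan_projection t \<in> ?M" using cartan_projection_in symmetric_traceless_subset by blast
    moreover from this have "t - cartan_projection t \<in> ?M" using t by (intro tensor.subspace_diff subM)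
    ultimately show ?thesis using add [of "t - cartan_projection t" "cartan_projection t"] by simp
  qed
  ultimately show ?thesis using id [OF cartan_projection_in] by simp
qed

lemma cartan_product_eq:
  fixes X Y :: "'n::{finite, linorder} cmat"
  assumes "CARD('n) \<ge> 2" "X \<in> sl" "Y \<in> sl"
  shows "cartan_product X Y = cartan_projection (pure [X, Y])"
proof -
  have "invariant_projection (tensor_power 2 sl) cartan_square
      (SOME P. invariant_projection (tensor_power 2 sl) (cartan_square :: 'n tensor set) P)"
    using invariant_projection_cartan_projection unfolding cartan_square_eq [OF assms(1)]
    by (rule someI [of "invariant_projection (tensor_power 2 sl) symmetric_traceless"])
  then show ?thesis
    unfolding cartan_product_def cartan_square_eq [OF assms(1)]
    by (intro invariant_projection_unique assms pure_2_in_tensor_power)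
qed

section \<open>The Killing form\<close>

lemma mat_unit_expansion: "(\<Sum>i\<in>UNIV. \<Sum>j\<in>UNIV. mscale (A $ i $ j) (mat_unit i j)) = A"
  by (simp add: vec_eq_iff mscale_apply mat_unit_apply mult_delta_right sum_if_const
    if_distrib [of "\<lambda>x. _ * x"] cong: if_cong)

text \<open>The hypotheses write \<open>f\<close> as a sum of operators of rank one, each the product of a coordinate functional
  with a vector of \<open>V\<close>. The trace of such an operator is the value of the functional on the vector, in
  any basis. This computes traces on \<open>sl\<close> from matrix units, which are a basis of the larger space.\<close>

lemma trace_on_eq:
  fixes f :: "'n::finite cmat \<Rightarrow> 'n cmat"
  assumes V: "cmat.subspace V"
    and f: "\<And>Z. Z \<in> V \<Longrightarrow> f Z = (\<Sum>i\<in>UNIV. \<Sum>j\<in>UNIV. mscale (Z $ i $ j) (u i j))"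
    and u: "\<And>i j. u i j \<in> V"
  shows "trace_on V f = (\<Sum>i\<in>UNIV. \<Sum>j\<in>UNIV. u i j $ i $ j)"
proof -
  have "\<exists>B. cmat.independent B \<and> cmat.span B = V"
  proof -
    obtain B where "B \<subseteq> V" "cmat.independent B" "V \<subseteq> cmat.span B"
      using cmat.maximal_independent_subset by blast
    moreover have "cmat.span B \<subseteq> V" using \<open>B \<subseteq> V\<close> V by (rule cmat.span_minimal)
    ultimately show ?thesis by blast
  qed
  define B where "B = (SOME B. cmat.independent B \<and> cmat.span B = V)"
  have B: "cmat.independent B" "cmat.span B = V"
    using someI_ex [OF \<open>\<exists>B. cmat.independent B \<and> cmat.span B = V\<close>] by (simp_all add: B_def)
  have "finite B"
  proof -
    let ?E = "(\<lambda>(i, j). mat_unit i j) ` (UNIV :: ('n \<times> 'n) set)"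
    have "A \<in> cmat.span ?E" for A
    proof -
      have "(\<Sum>i\<in>UNIV. \<Sum>j\<in>UNIV. mscale (A $ i $ j) (mat_unit i j)) \<in> cmat.span ?E"
        by (intro cmat.span_sum cmat.span_scale cmat.span_base) auto
      then show ?thesis by (simp only: mat_unit_expansion)
    qed
    then show ?thesis using cmat.independent_span_bound [of ?E B] B(1) by auto
  qed
  have rep: "cmat.representation B (f b) b =
      (\<Sum>i\<in>UNIV. \<Sum>j\<in>UNIV. b $ i $ j * cmat.representation B (u i j) b)" if "b \<in> B" for b
  proof -
    have "b \<in> V" using that B(2) cmat.span_base by blast
    then show ?thesis
      using u by (simp add: f cmat.representation_sum [OF B(1)] cmat.representation_scale [OF B(1)]
          B(2) cmat.subspace_sum [OF V] cmat.subspace_scale [OF V])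
  qed
  have expand: "(\<Sum>b\<in>B. b $ i $ j * cmat.representation B v b) = v $ i $ j" if "v \<in> V" for v i j
  proof -
    have "v = (\<Sum>b\<in>B. mscale (cmat.representation B v b) b)"
      using cmat.sum_representation_eq [OF B(1), of v B] that B(2) \<open>finite B\<close> by simp
    then have "v $ i $ j = (\<Sum>b\<in>B. mscale (cmat.representation B v b) b) $ i $ j" by simp
    then show ?thesis by (simp add: mscale_apply mult.commute)
  qed
  have "trace_on V f = (\<Sum>b\<in>B. \<Sum>i\<in>UNIV. \<Sum>j\<in>UNIV. b $ i $ j * cmat.representation B (u i j) b)"
    by (simp add: trace_on_def B_def [symmetric] rep)
  also have "\<dots> = (\<Sum>i\<in>UNIV. \<Sum>j\<in>UNIV. \<Sum>b\<in>B. b $ i $ j * cmat.representation B (u i j) b)"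
    by (subst sum.swap) (simp add: sum.swap [of _ B])
  also have "\<dots> = (\<Sum>i\<in>UNIV. \<Sum>j\<in>UNIV. u i j $ i $ j)"
    by (simp add: expand u)
  finally show ?thesis .
qed

lemma trace_zero: "trace 0 = 0"
  by (simp add: trace_def)

lemma subspace_sl: "cmat.subspace sl"
  by (rule cmat.subspaceI) (simp_all add: sl_def trace_add trace_mscale trace_zero)

lemma trace_matrix_mult: "trace (X ** Y) = (\<Sum>i\<in>UNIV. \<Sum>j\<in>UNIV. X $ i $ j * Y $ j $ i)"
  by (simp add: trace_def matrix_matrix_mult_def)

lemma killing_eq:
  fixes X Y :: "'n::finite cmat"
  shows "killing X Y = 2 * of_nat CARD('n) * trace (X ** Y) - 2 * trace X * trace Y"
proof -
  have expand: "bracket X (bracket Y Z) =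
      (\<Sum>i\<in>UNIV. \<Sum>j\<in>UNIV. mscale (Z $ i $ j) (bracket X (bracket Y (mat_unit i j))))" for Z
  proof -
    have sum: "bracket A (\<Sum>i\<in>UNIV. g i) = (\<Sum>i\<in>UNIV. bracket A (g i))"
      for A and g :: "'n \<Rightarrow> 'n cmat"
    proof -
      have "bracket A (\<Sum>i\<in>F. g i) = (\<Sum>i\<in>F. bracket A (g i))" for F
        by (induction F rule: infinite_finite_induct)
          (simp_all add: bracket_add_right, simp_all add: bracket_def)
      then show ?thesis .
    qed
    have "bracket X (bracket Y Z) =
        bracket X (bracket Y (\<Sum>i\<in>UNIV. \<Sum>j\<in>UNIV. mscale (Z $ i $ j) (mat_unit i j)))"
      by (simp only: mat_unit_expansion)
    then show ?thesis by (simp only: sum bracket_scale_right)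
  qed
  have "killing X Y = (\<Sum>i\<in>UNIV. \<Sum>j\<in>UNIV. bracket X (bracket Y (mat_unit i j)) $ i $ j)"
    unfolding killing_def by (rule trace_on_eq [OF subspace_sl expand bracket_sl])
  also have "\<dots> = (\<Sum>i\<in>UNIV. \<Sum>j\<in>UNIV.
      (\<Sum>m\<in>UNIV. X $ i $ m * Y $ m $ i) - X $ i $ i * Y $ j $ j - Y $ i $ i * X $ j $ j
        + (\<Sum>m\<in>UNIV. Y $ j $ m * X $ m $ j))"
    by (intro sum.cong refl)
      (simp add: bracket_nth [of X] bracket_mat_unit_right_apply sum_subtractf mult_delta_left
        mult_delta_right left_diff_distrib right_diff_distrib if_distrib [of "\<lambda>x. _ * x"]
        if_distrib [of "\<lambda>x. x * _"] mult.commute cong: if_cong)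
  also have "\<dots> = 2 * of_nat CARD('n) * trace (X ** Y) - 2 * trace X * trace Y"
  proof -
    have "(\<Sum>i\<in>UNIV. \<Sum>j\<in>(UNIV :: 'n set). \<Sum>m\<in>UNIV. X $ i $ m * Y $ m $ i)
        = of_nat CARD('n) * trace (X ** Y)"
      by (simp add: trace_matrix_mult sum_distrib_left)
    moreover have "(\<Sum>i\<in>(UNIV :: 'n set). \<Sum>j\<in>UNIV. \<Sum>m\<in>UNIV. Y $ j $ m * X $ m $ j)
        = of_nat CARD('n) * trace (X ** Y)"
      by (simp add: trace_mul_sym [of X Y]) (simp add: trace_matrix_mult)
    moreover have "(\<Sum>i\<in>UNIV. \<Sum>j\<in>UNIV. A $ i $ i * B $ j $ j) = trace A * trace B"
      for A B :: "'n cmat"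
      by (simp add: trace_def sum_product)
    ultimately show ?thesis by (simp only: sum.distrib sum_subtractf) (simp add: algebra_simps)
  qed
  finally show ?thesis .
qed

lemma mat_unit_mult: "mat_unit a b ** mat_unit c d = (if b = c then mat_unit a d else 0)"
proof -
  have "(\<Sum>m\<in>UNIV. mat_unit a b $ i $ m * mat_unit c d $ m $ j) =
      (if b = c then mat_unit a d else 0) $ i $ j" for i j
    by (simp add: mat_unit_apply mult_delta_left mult_delta_right sum_if_const cong: if_cong)
  then show ?thesis by (simp add: vec_eq_iff matrix_matrix_mult_def)
qed

lemma killing_traceless_mat_unit:
  "killing (traceless_part (mat_unit i j)) (traceless_part (mat_unit k l :: 'n::finite cmat)) =
     (if j = k \<and> i = l then 2 * of_nat CARD('n) else 0) - (if i = j \<and> k = l then 2 else 0)"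
proof -
  have "killing (traceless_part X) (traceless_part Y) = killing X Y" for X Y :: "'n cmat"
    by (simp add: killing_def bracket_traceless_part)
  then have eq: "killing (traceless_part (mat_unit i j)) (traceless_part (mat_unit k l :: 'n cmat)) =
      2 * of_nat CARD('n) * trace (if j = k then mat_unit i l else 0 :: 'n cmat)
        - 2 * trace (mat_unit i j :: 'n cmat) * trace (mat_unit k l :: 'n cmat)"
    by (simp only: killing_eq mat_unit_mult)
  have "trace (if j = k then mat_unit i l else 0 :: 'n cmat) = (if j = k \<and> i = l then 1 else 0)"
    by (cases "j = k") (simp_all only: if_True if_False trace_mat_unit trace_zero simp_thms)
  moreover have "2 * c * (if P then 1 else 0) - 2 * (if Q then 1 else 0) * (if R then 1 else 0) =
      (if P then 2 * c else 0) - (if Q \<and> R then 2 else 0)" for P Q R and c :: complex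
    by simp
  ultimately show ?thesis unfolding eq trace_mat_unit by (simp only:)
qed

section \<open>Ideals of the tensor algebra\<close>

lemma tmult_diff_left: "tmult (t - u) v = tmult t v - tmult u v"
  by (simp add: tmult_def fun_eq_iff left_diff_distrib sum_subtractf)

lemma tmult_diff_right: "tmult v (t - u) = tmult v t - tmult v u"
  by (simp add: tmult_def fun_eq_iff right_diff_distrib sum_subtractf)

lemma pure_1_apply: "pure [X] w = (case w of [(i, j)] \<Rightarrow> X $ i $ j | _ \<Rightarrow> 0)"
  by (cases "([X], w)" rule: pure.cases) (auto split: list.split)

lemma pure_1_linear:
  shows pure_1_add: "pure [X + Y] = pure [X] + pure [Y]"
    and pure_1_diff: "pure [X - Y] = pure [X] - pure [Y]"
    and pure_1_scale: "pure [mscale c X] = tscale c (pure [X])"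
    and pure_1_zero: "pure [0] = 0"
  by (auto simp: fun_eq_iff pure_1_apply tscale_apply mscale_apply split: list.split)

lemma pure_in_carrier: "set Xs \<subseteq> V \<Longrightarrow> pure Xs \<in> carrier (tensor_algebra V)"
  unfolding tensor_algebra_def by (auto intro!: tensor.span_base)

lemma subspace_carrier: "tensor.subspace (carrier (tensor_algebra V))"
  by (simp add: tensor_algebra_def tensor.subspace_span)

lemma tensor_power_subset_carrier: "tensor_power s V \<subseteq> carrier (tensor_algebra V)"
  unfolding tensor_power_def tensor_algebra_def by (auto intro!: tensor.span_mono)

lemma ideal_tmult_left:
  assumes "ideal I (tensor_algebra V)" "t \<in> I" "u \<in> carrier (tensor_algebra V)"
  shows "tmult u t \<in> I"
  using ideal.I_l_closed [OF assms] by (simp add: tensor_algebra_def)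

lemma ideal_tmult_right:
  assumes "ideal I (tensor_algebra V)" "t \<in> I" "u \<in> carrier (tensor_algebra V)"
  shows "tmult t u \<in> I"
  using ideal.I_r_closed [OF assms] by (simp add: tensor_algebra_def)

lemma ideal_subspace:
  assumes "ideal I (tensor_algebra V)"
  shows "tensor.subspace I"
proof (rule tensor.subspaceI)
  note group = ideal.axioms(1) [OF assms]
  show "0 \<in> I" using additive_subgroup.zero_closed [OF group] by (simp add: tensor_algebra_def)
  show "t + u \<in> I" if "t \<in> I" "u \<in> I" for t u
    using additive_subgroup.a_closed [OF group that] by (simp add: tensor_algebra_def)
  show "tscale c t \<in> I" if "t \<in> I" for c t
  proof -
    have "tscale c (pure []) \<in> carrier (tensor_algebra V)"
      by (intro tensor.subspace_scale subspace_carrier pure_in_carrier) simp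
    then have "tmult (tscale c (pure [])) t \<in> I"
      by (rule ideal_tmult_left [OF assms that])
    then show ?thesis by (simp add: tmult_scale_left tmult_one)
  qed
qed

text \<open>Modulo the ideal, \<open>x q p = b z p = b a x\<close> by \<open>r2\<close> and \<open>r3\<close>, and \<open>x a (b - 1) = a x (b - 1) = a b x\<close> by
  \<open>r4\<close> and \<open>r5\<close>. Since \<open>a\<close> and \<open>b\<close> commute, \<open>x (q p - a b + a)\<close> vanishes, whereas by \<open>r1\<close> it is \<open>k x\<close>. The
  letters stand for the entries \<open>y\<^sub>a\<^sub>a, y\<^sub>b\<^sub>b, y\<^sub>a\<^sub>b, y\<^sub>b\<^sub>a, y\<^sub>c\<^sub>b, y\<^sub>c\<^sub>a\<close>, named \<open>a, b, p, q, x, z\<close>.\<close>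

lemma rank_one_relations_force_multiple:
  assumes I: "ideal I (tensor_algebra V)"
    and carrier: "a \<in> carrier (tensor_algebra V)" "b \<in> carrier (tensor_algebra V)"
      "p \<in> carrier (tensor_algebra V)" "x \<in> carrier (tensor_algebra V)"
    and r1: "tmult q p - tmult a b + a - tscale k (pure []) \<in> I"
    and r2: "tmult x q - tmult b z \<in> I"
    and r3: "tmult z p - tmult a x \<in> I"
    and r4: "tmult x a - tmult a x \<in> I"
    and r5: "tmult x b - tmult b x - x \<in> I"
    and r6: "tmult a b - tmult b a \<in> I"
  shows "tscale k x \<in> I"
proof -
  let ?r1 = "tmult q p - tmult a b + a - tscale k (pure [])"
  let ?r5 = "tmult x b - tmult b x - x"
  have "b - pure [] \<in> carrier (tensor_algebra V)"
    using carrier(2) by (intro tensor.subspace_diff subspace_carrier pure_in_carrier) simp_all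
  then have "tmult (tmult x a - tmult a x) (b - pure []) \<in> I"
    by (rule ideal_tmult_right [OF I r4])
  note terms = ideal_tmult_right [OF I r2 carrier(3)] ideal_tmult_left [OF I r3 carrier(2)]
    ideal_tmult_left [OF I r1 carrier(4)] this
    ideal_tmult_left [OF I r5 carrier(1)] ideal_tmult_right [OF I r6 carrier(4)]
  note sub = ideal_subspace [OF I]
  have "tmult (tmult x q - tmult b z) p + tmult b (tmult z p - tmult a x) - tmult x ?r1
      - tmult (tmult x a - tmult a x) (b - pure []) - tmult a ?r5
      - tmult (tmult a b - tmult b a) x \<in> I"
    by (rule tensor.subspace_diff [OF sub tensor.subspace_diff [OF sub tensor.subspace_diff [OF sub
        tensor.subspace_diff [OF sub tensor.subspace_add [OF sub terms(1) terms(2)] terms(3)]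
        terms(4)] terms(5)] terms(6)])
  also have "tmult (tmult x q - tmult b z) p + tmult b (tmult z p - tmult a x) - tmult x ?r1
      - tmult (tmult x a - tmult a x) (b - pure []) - tmult a ?r5
      - tmult (tmult a b - tmult b a) x = tscale k x"
    by (simp add: tmult_add_left tmult_add_right tmult_diff_left tmult_diff_right tmult_assoc
        tmult_one tmult_scale_right)
  finally show ?thesis .
qed

section \<open>Relations between matrix units modulo the ideal\<close>

definition relators :: "complex \<Rightarrow> 'n::{finite, linorder} tensor set" where
  "relators lam = {pure [X, Y] - cartan_product X Y - tscale (1 / 2) (pure [bracket X Y])
     - tscale (lam * killing X Y) (pure []) | X Y. X \<in> sl \<and> Y \<in> sl}"

lemma relators_subset_carrier:
  assumes "CARD('n) \<ge> 2"
  shows "relators lam \<subseteq> carrier (tensor_algebra (sl :: 'n::{finite, linorder} cmat set))"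
proof -
  have "cartan_product X Y \<in> carrier (tensor_algebra sl)" if "X \<in> sl" "Y \<in> sl" for X Y :: "'n cmat"
    using cartan_product_eq [OF assms that] cartan_projection_in symmetric_traceless_subset
      tensor_power_subset_carrier [of 2 sl] by fastforce
  then show ?thesis
    unfolding relators_def
    by (auto intro!: tensor.subspace_diff tensor.subspace_scale subspace_carrier pure_in_carrier
        bracket_sl)
qed

text \<open>Generators with the same Cartan product differ by a relation that expresses a quadratic tensor by
  terms of lower degree.\<close>

lemma relator_difference:
  fixes X Y X' Y' :: "'n::{finite, linorder} cmat"
  assumes "CARD('n) \<ge> 2" "ideal I (tensor_algebra sl)" "relators lam \<subseteq> I"
    and "cartan_projection (pure [X, Y]) = cartan_projection (pure [X', Y'])"
  shows "pure [traceless_part X, traceless_part Y] - pure [traceless_part X', traceless_part Y']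
    - tscale (1 / 2) (pure [bracket X Y] - pure [bracket X' Y'])
    - tscale (lam * (killing (traceless_part X) (traceless_part Y)
        - killing (traceless_part X') (traceless_part Y'))) (pure []) \<in> I"
proof -
  define r where "r A B = pure [A, B] - cartan_product A B - tscale (1 / 2) (pure [bracket A B])
     - tscale (lam * killing A B) (pure [])" for A B :: "'n cmat"
  have "r (traceless_part X) (traceless_part Y) \<in> I" "r (traceless_part X') (traceless_part Y') \<in> I"
    using assms(3) traceless_part_sl unfolding relators_def r_def by blast+
  then have "r (traceless_part X) (traceless_part Y) - r (traceless_part X') (traceless_part Y') \<in> I"
    by (rule tensor.subspace_diff [OF ideal_subspace [OF assms(2)]])
  moreover have "cartan_product (traceless_part X) (traceless_part Y)
      = cartan_product (traceless_part X') (traceless_part Y')"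
    by (simp add: cartan_product_eq [OF assms(1)] traceless_part_sl
        cartan_projection_traceless_part assms(4))
  then have "r (traceless_part X) (traceless_part Y) - r (traceless_part X') (traceless_part Y')
    = pure [traceless_part X, traceless_part Y] - pure [traceless_part X', traceless_part Y']
      - tscale (1 / 2) (pure [bracket X Y] - pure [bracket X' Y'])
      - tscale (lam * (killing (traceless_part X) (traceless_part Y)
        - killing (traceless_part X') (traceless_part Y'))) (pure [])"
    by (simp add: r_def bracket_traceless_part fun_eq_iff tscale_apply algebra_simps)
  ultimately show ?thesis by simp
qed

lemma killing_commute: "killing Y X = killing X Y"
  unfolding killing_eq trace_mul_sym [of Y X] by (simp only: ac_simps)

lemma commutator_in_ideal:
  fixes X Y :: "'n::{finite, linorder} cmat"
  assumes "CARD('n) \<ge> 2" "ideal I (tensor_algebra sl)" "relators lam \<subseteq> I"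
  shows "pure [traceless_part X, traceless_part Y] - pure [traceless_part Y, traceless_part X]
    - pure [bracket X Y] \<in> I"
proof -
  have "killing (traceless_part Y) (traceless_part X) = killing (traceless_part X) (traceless_part Y)"
    by (rule killing_commute)
  moreover have "pure [bracket X Y] - pure [bracket Y X] = tscale 2 (pure [bracket X Y])"
    by (simp add: bracket_def pure_1_diff fun_eq_iff tscale_apply algebra_simps)
  ultimately show ?thesis
    using relator_difference [OF assms cartan_projection_swap, of X Y] by simp
qed

lemma traceless_part_off_diagonal: "a \<noteq> b \<Longrightarrow> traceless_part (mat_unit a b) = mat_unit a b"
  by (rule traceless_part_of_sl) (simp add: sl_def trace_mat_unit)

text \<open>The elements \<open>y i j\<close> are traceless parts of matrix units, shifted on the diagonal by \<open>1 / 2\<close>. The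
  shift absorbs half of the bracket that a relator contributes to a minor, so that the minors in
  \<open>trade\<close> vanish without a term of lower degree.\<close>

lemma mat_unit_in_ideal:
  fixes a b c :: "'n::{finite, linorder}"
  assumes I: "ideal I (tensor_algebra (sl :: 'n cmat set))" "relators lam \<subseteq> I"
    and distinct: "a \<noteq> b" "a \<noteq> c" "b \<noteq> c"
    and lam: "lam \<noteq> - 1 / (8 * (of_nat CARD('n) + 1))"
  shows "pure [mat_unit c b] \<in> I"
proof -
  have "card {a, b, c} \<le> CARD('n)" by (rule card_mono) auto
  then have n: "CARD('n) \<ge> 2" using distinct by simp
  note diff = relator_difference [OF n I]
  note comm = commutator_in_ideal [OF n I]
  \<comment> \<open>\<open>1 / 4\<close> is the shift \<open>1 / 2\<close> of \<open>y a a\<close> minus the product of two shifts; \<open>2 (n + 1)\<close> comes from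
      the Killing forms in \<open>kill\<close>.\<close>
  define k where "k = 1 / 4 + 2 * (of_nat CARD('n) + 1) * lam"
  define y where "y i j = pure [traceless_part (mat_unit i j)]
      + tscale (if i = j then 1 / 2 else 0) (pure [])" for i j :: 'n
  have y: "y i j \<in> carrier (tensor_algebra sl)" for i j
    unfolding y_def
    by (intro tensor.subspace_add tensor.subspace_scale subspace_carrier pure_in_carrier)
      (simp_all add: traceless_part_sl)
  have yy: "tmult (y i j) (y k l) = pure [traceless_part (mat_unit i j), traceless_part (mat_unit k l)]
      + tscale (if i = j then 1 / 2 else 0) (pure [traceless_part (mat_unit k l)])
      + tscale (if k = l then 1 / 2 else 0) (pure [traceless_part (mat_unit i j)])
      + tscale (if i = j \<and> k = l then 1 / 4 else 0) (pure [])" for i j k l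
    by (simp add: y_def tmult_add_left tmult_add_right tmult_scale_left tmult_scale_right tmult_one
        tmult_pure fun_eq_iff tscale_apply algebra_simps)
  have trade: "tmult (y c j) (y j i) - tmult (y j j) (y c i) \<in> I" if "i \<noteq> j" "i \<noteq> c" "j \<noteq> c" for i j
  proof -
    have "killing (traceless_part (mat_unit c j)) (traceless_part (mat_unit j i)) = 0"
      "killing (traceless_part (mat_unit j j)) (traceless_part (mat_unit c i)) = 0"
      using that unfolding killing_traceless_mat_unit by simp_all
    from diff [OF cartan_projection_mat_unit_exchange [of c j j i], unfolded this]
    show ?thesis using that
      by (simp add: yy bracket_mat_unit traceless_part_off_diagonal pure_1_zero diff_diff_eq)
  qed
  have swap: "tmult (y i j) (y k l) - tmult (y k l) (y i j)
      - pure [bracket (mat_unit i j) (mat_unit k l)] \<in> I" for i j k l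
    using comm [of "mat_unit i j" "mat_unit k l"] by (simp add: yy algebra_simps conj_commute)
  have "tscale k (y c b) \<in> I"
  proof (rule rank_one_relations_force_multiple [OF I(1) y y y y, of "y b a" a b a a b b k c b "y c a"])
    have kill: "killing (traceless_part (mat_unit a a)) (traceless_part (mat_unit b b)) = - 2"
      "killing (traceless_part (mat_unit b a)) (traceless_part (mat_unit a b)) = 2 * of_nat CARD('n)"
      using distinct unfolding killing_traceless_mat_unit by simp_all
    have "- (pure [traceless_part (mat_unit a a), traceless_part (mat_unit b b)]
        - pure [traceless_part (mat_unit b a), traceless_part (mat_unit a b)]
        - tscale (1 / 2) (pure [bracket (mat_unit a a) (mat_unit b b)]
            - pure [bracket (mat_unit b a) (mat_unit a b)])
        - tscale (lam * (- 2 - 2 * of_nat CARD('n))) (pure [])) \<in> I" (is "- ?d \<in> I")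
      by (rule tensor.subspace_neg [OF ideal_subspace [OF I(1)]
          diff [OF cartan_projection_mat_unit_exchange [of a a b b], unfolded kill]])
    also have "bracket (mat_unit a a) (mat_unit b b) = (0 :: 'n cmat)"
      using distinct by (simp add: bracket_mat_unit)
    also have "bracket (mat_unit b a) (mat_unit a b) =
        traceless_part (mat_unit b b) - traceless_part (mat_unit a a :: 'n cmat)"
      by (simp add: bracket_mat_unit traceless_part_def trace_mat_unit)
    also have "- (pure [traceless_part (mat_unit a a), traceless_part (mat_unit b b)]
        - pure [traceless_part (mat_unit b a), traceless_part (mat_unit a b)]
        - tscale (1 / 2) (pure [0]
            - pure [traceless_part (mat_unit b b) - traceless_part (mat_unit a a)])
        - tscale (lam * (- 2 - 2 * of_nat CARD('n))) (pure []))
      = tmult (y b a) (y a b) - tmult (y a a) (y b b) + y a a - tscale k (pure [])"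
      using distinct unfolding yy
      by (simp add: y_def k_def pure_1_zero pure_1_diff fun_eq_iff tscale_apply)
        (simp add: field_simps)
    finally show "tmult (y b a) (y a b) - tmult (y a a) (y b b) + y a a - tscale k (pure []) \<in> I" .
    show "tmult (y c b) (y b a) - tmult (y b b) (y c a) \<in> I"
      "tmult (y c a) (y a b) - tmult (y a a) (y c b) \<in> I"
      using distinct by (auto intro!: trade)
    show "tmult (y c b) (y a a) - tmult (y a a) (y c b) \<in> I"
      "tmult (y a a) (y b b) - tmult (y b b) (y a a) \<in> I"
      "tmult (y c b) (y b b) - tmult (y b b) (y c b) - y c b \<in> I"
      using swap [of c b a a] swap [of a a b b] swap [of c b b b] distinct
      by (simp_all add: bracket_mat_unit pure_1_zero y_def traceless_part_off_diagonal)
  qed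
  moreover have "k \<noteq> 0"
  proof
    assume "k = 0"
    have "(8 * (of_nat CARD('n) + 1)) * lam = 4 * k - 1"
      by (simp add: k_def algebra_simps)
    with \<open>k = 0\<close> have "(8 * (of_nat CARD('n) + 1)) * lam = - 1" by simp
    moreover have "8 * (of_nat CARD('n) + 1) \<noteq> (0 :: complex)"
      unfolding mult_eq_0_iff using card_plus_nonzero(1) [where 'n = 'n] by simp
    ultimately have "lam = - 1 / (8 * (of_nat CARD('n) + 1))"
      by (metis nonzero_mult_div_cancel_left)
    then show False using lam by simp
  qed
  ultimately have "y c b \<in> I"
    using tensor.subspace_scale [OF ideal_subspace [OF I(1)], of "tscale k (y c b)" "1 / k"]
    by simp
  moreover have "y c b = pure [mat_unit c b]"
    using distinct by (simp add: y_def traceless_part_off_diagonal)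
  ultimately show ?thesis by simp
qed

text \<open>The commutators of opposite matrix units span the traceless diagonal matrices.\<close>

lemma sl_in_ideal:
  fixes I :: "'n::{finite, linorder} tensor set"
  assumes n: "CARD('n) \<ge> 2" and I: "ideal I (tensor_algebra sl)" "relators lam \<subseteq> I"
    and off: "\<And>a b. a \<noteq> b \<Longrightarrow> pure [mat_unit a b] \<in> I" and "X \<in> sl"
  shows "pure [X] \<in> I"
proof -
  note sub = ideal_subspace [OF I(1)]
  have diag: "pure [mat_unit a a - mat_unit b b] \<in> I" for a b
  proof (cases "a = b")
    case True
    then show ?thesis using sub by (simp add: pure_1_zero tensor.subspace_0)
  next
    case ne: False
    have prod: "pure [mat_unit i j, mat_unit j i] \<in> I" if "i \<noteq> j" for i j
    proof -
      have "pure [mat_unit j i] \<in> carrier (tensor_algebra sl)"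
        using that by (intro pure_in_carrier) (simp add: sl_def trace_mat_unit)
      from ideal_tmult_right [OF I(1) off [OF that] this] show ?thesis by (simp add: tmult_pure)
    qed
    let ?P = "pure [mat_unit a b, mat_unit b a]" and ?Q = "pure [mat_unit b a, mat_unit a b]"
    have "?P - ?Q - pure [bracket (mat_unit a b) (mat_unit b a)] \<in> I"
      using commutator_in_ideal [OF n I, of "mat_unit a b" "mat_unit b a"] ne
      by (simp add: traceless_part_off_diagonal)
    moreover have "?P - ?Q \<in> I"
      using ne by (intro tensor.subspace_diff [OF sub] prod) auto
    ultimately have "?P - ?Q - (?P - ?Q - pure [bracket (mat_unit a b) (mat_unit b a)]) \<in> I"
      using tensor.subspace_diff [OF sub] by metis
    then show ?thesis by (simp add: bracket_mat_unit)
  qed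
  obtain m :: 'n where True by simp
  define u where "u i j = (if i = j then mat_unit i i - mat_unit m m else mat_unit i j)" for i j
  \<comment> \<open>Subtracting the unit at \<open>m\<close> from the diagonal units changes the sum by a multiple of
      the trace of \<open>X\<close>, which is zero.\<close>
  have eq: "(\<Sum>i\<in>UNIV. \<Sum>j\<in>UNIV. mscale (X $ i $ j) (u i j)) = X"
  proof -
    have "(\<Sum>i\<in>UNIV. \<Sum>j\<in>UNIV. mscale (X $ i $ j) (u i j)) $ r $ s = X $ r $ s" for r s
    proof -
      have "(\<Sum>i\<in>UNIV. \<Sum>j\<in>UNIV. mscale (X $ i $ j) (u i j)) $ r $ s
          = (\<Sum>i\<in>UNIV. \<Sum>j\<in>UNIV. X $ i $ j * mat_unit i j $ r $ s
              - (if i = j then X $ i $ i * mat_unit m m $ r $ s else 0))"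
        by (simp only: sum_component)
          (intro sum.cong refl; simp add: u_def mscale_apply right_diff_distrib)
      also have "\<dots> = (\<Sum>i\<in>UNIV. \<Sum>j\<in>UNIV. X $ i $ j * mat_unit i j $ r $ s)
            - (\<Sum>i\<in>UNIV. \<Sum>j\<in>UNIV. if i = j then X $ i $ i * mat_unit m m $ r $ s else 0)"
        by (simp only: sum_subtractf)
      also have "(\<Sum>i\<in>UNIV. \<Sum>j\<in>UNIV. X $ i $ j * mat_unit i j $ r $ s) = X $ r $ s"
        by (simp add: mat_unit_apply mult_delta_right sum_if_const if_distrib [of "\<lambda>x. _ * x"]
            cong: if_cong)
      also have "(\<Sum>i\<in>UNIV. \<Sum>j\<in>UNIV. if i = j then X $ i $ i * mat_unit m m $ r $ s else 0)
          = trace X * mat_unit m m $ r $ s"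
        by (simp add: trace_def sum_distrib_right)
      finally show ?thesis using \<open>X \<in> sl\<close> by (simp add: sl_def)
    qed
    then show ?thesis by (simp add: vec_eq_iff)
  qed
  have "cmat.subspace {A. pure [A] \<in> I}"
    using sub by (intro cmat.subspaceI)
      (auto simp: pure_1_linear intro: tensor.subspace_0 tensor.subspace_add tensor.subspace_scale)
  then have "(\<Sum>i\<in>UNIV. \<Sum>j\<in>UNIV. mscale (X $ i $ j) (u i j)) \<in> {A. pure [A] \<in> I}"
    by (intro cmat.subspace_sum cmat.subspace_scale) (auto simp: u_def diag off)
  then show ?thesis unfolding eq by simp
qed

theorem theorem4p1:
  fixes lam :: complex
  assumes "CARD('n::{finite, linorder}) \<ge> 3"
    and "lam \<noteq> - 1 / (8 * (of_nat CARD('n) + 1))"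
  shows "{pure [X] | X. X \<in> (sl :: 'n cmat set)}
    \<subseteq> Idl\<^bsub>tensor_algebra (sl :: 'n cmat set)\<^esub>
        {pure [X, Y] - cartan_product X Y - tscale (1 / 2) (pure [bracket X Y])
           - tscale (lam * killing X Y) (pure []) | X Y. X \<in> sl \<and> Y \<in> sl}"
proof -
  have n: "CARD('n) \<ge> 2" using assms(1) by simp
  define I where "I = Idl\<^bsub>tensor_algebra (sl :: 'n cmat set)\<^esub> relators lam"
  note carrier = relators_subset_carrier [OF n, of lam]
  have I: "ideal I (tensor_algebra sl)" "relators lam \<subseteq> I"
    unfolding I_def by (rule ring.genideal_ideal [OF ring_tensor_algebra carrier])
      (rule ring.genideal_self [OF ring_tensor_algebra carrier])
  have "pure [mat_unit a b] \<in> I" if "a \<noteq> b" for a b :: 'n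
  proof -
    have "card {a, b} < CARD('n)" using assms(1) card_insert_le_m1 [of 2 "{b}" a] by simp
    then obtain c where "c \<notin> {a, b}"
      by (metis UNIV_eq_I less_irrefl)
    then show ?thesis using mat_unit_in_ideal [OF I _ _ _ assms(2), of c b a] that by auto
  qed
  then have "pure [X] \<in> I" if "X \<in> sl" for X
    using sl_in_ideal [OF n I] that by blast
  then show ?thesis unfolding I_def relators_def by blast
qed

end
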